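(* Let $K$ and $L$ be compact Hausdorff spaces. Let $T\colon\mathcal{C}(L)\to\mathcal{C}(K)$ be a linear isometry onto a complemented subspace $E$ of $\mathcal{C}(K)$ and let $P\colon\mathcal{C}(K)\to E$ be a norm-$1$ projection onto $E$. Then there exist a closed subset $F$ of $K$, a continuous surjection $\rho\colon F\to L$, and continuous mappings $\sigma\colon F\to\{-1,1\}$ and $\phi\colon L\to S_{\mathcal{M}(F)}$ such that: (i) for each $x\in L$, $\operatorname{supp}(\phi(x))\subseteq\rho^{-1}(x)$; (ii) for each $f\in\mathcal{C}(L)$ and $y\in F$, $T(f)(y)=\sigma(y)f(\rho(y))$; (iii) for each $g\in\mathcal{C}(K)$ and $y\in F$, $P(g)(y)=\sigma(y)\big\langle\phi(\rho(y)),g\big\rangle$.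
   Context: $\mathcal{C}(K)$ is the Banach space of continuous real functions on $K$ with the sup norm. $\mathcal{M}(K)=\mathcal{C}(K)^*$ is the space of regular signed Borel measures on $K$ with the variation norm and $\langle\mu,g\rangle=\int g\,d\mu$. For closed $F\subseteq K$, $\mathcal{M}(F)$ is identified with the measures in $\mathcal{M}(K)$ whose support is contained in $F$; $S_{\mathcal{M}(F)}$ is its unit sphere, endowed with the weak$^*$ topology. $\operatorname{supp}(\mu)$ is the smallest closed set $S$ with $|\mu|$ vanishing on its complement. A projection onto $E$ is a bounded linear operator $P:\mathcal{C}(K)\to E$ with $P\restriction E=\mathrm{id}_E$. *)

theory Defs
  imports "HOL-Analysis.Analysis"
begin

text \<open>
  For a type \<open>'k :: t2_space\<close> with compact universe, \<open>'k \<Rightarrow>\<^sub>C real\<close> is the Banach space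
  of all continuous real functions with the sup norm, since continuous functions on a compact
  space are bounded.
\<close>

definition projection_onto :: "'a::real_normed_vector set \<Rightarrow> ('a \<Rightarrow> 'a) \<Rightarrow> bool" where
  "projection_onto E P \<longleftrightarrow> bounded_linear P \<and> range P \<subseteq> E \<and> (\<forall>e\<in>E. P e = e)"

definition complemented_subspace :: "'a::real_normed_vector set \<Rightarrow> bool" where
  "complemented_subspace E \<longleftrightarrow> subspace E \<and> (\<exists>P. projection_onto E P)"

definition linear_isometry_onto ::
    "('a::real_normed_vector \<Rightarrow> 'b::real_normed_vector) \<Rightarrow> 'b set \<Rightarrow> bool" where
  "linear_isometry_onto T E \<longleftrightarrow> linear T \<and> (\<forall>f. norm (T f) = norm f) \<and> range T = E"


text \<open>
  Signed Borel measures are real-valued countably additive functions on the Borel sets. They are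
  set to 0 outside the Borel sets, so that two measures agreeing on Borel sets are equal.
\<close>

definition signed_borel_measure :: "('k::topological_space set \<Rightarrow> real) \<Rightarrow> bool" where
  "signed_borel_measure \<mu> \<longleftrightarrow>
     (\<forall>A::nat \<Rightarrow> 'k set. range A \<subseteq> sets borel \<longrightarrow> disjoint_family A \<longrightarrow>
        (\<lambda>i. \<mu> (A i)) sums \<mu> (\<Union>i. A i)) \<and>
     (\<forall>A. A \<notin> sets borel \<longrightarrow> \<mu> A = 0)"

text \<open>
  Jordan decomposition: the positive part is the upper variation, i.e. the supremum of
  \<open>\<mu> B\<close> over the Borel subsets \<open>B\<close> of \<open>A\<close>. Negative values are cut off at 0 by \<open>ennreal\<close>,
  which does not affect the supremum because of \<open>B = {}\<close>.
\<close>

definition pos_part :: "('k::topological_space set \<Rightarrow> real) \<Rightarrow> 'k measure" where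
  "pos_part \<mu> = measure_of UNIV (sets borel)
     (\<lambda>A. SUP B\<in>{B \<in> sets borel. B \<subseteq> A}. ennreal (\<mu> B))"

definition neg_part :: "('k::topological_space set \<Rightarrow> real) \<Rightarrow> 'k measure" where
  "neg_part \<mu> = pos_part (\<lambda>A. - \<mu> A)"

definition total_variation :: "('k::topological_space set \<Rightarrow> real) \<Rightarrow> 'k set \<Rightarrow> ennreal" where
  "total_variation \<mu> A = emeasure (pos_part \<mu>) A + emeasure (neg_part \<mu>) A"

definition regular_signed_measure :: "('k::topological_space set \<Rightarrow> real) \<Rightarrow> bool" where
  "regular_signed_measure \<mu> \<longleftrightarrow>
     (\<forall>A\<in>sets borel.
        total_variation \<mu> A = (SUP C\<in>{C. C \<subseteq> A \<and> compact C}. total_variation \<mu> C) \<and>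
        total_variation \<mu> A = (INF U\<in>{U. A \<subseteq> U \<and> open U}. total_variation \<mu> U))"

definition signed_integral :: "('k::topological_space set \<Rightarrow> real) \<Rightarrow> ('k \<Rightarrow> real) \<Rightarrow> real" where
  "signed_integral \<mu> g = (LINT y|pos_part \<mu>. g y) - (LINT y|neg_part \<mu>. g y)"

definition supp :: "('k::topological_space set \<Rightarrow> real) \<Rightarrow> 'k set" where
  "supp \<mu> = (LEAST S. closed S \<and> total_variation \<mu> (- S) = 0)"

text \<open>\<open>measures_on F\<close> is M(F), viewed inside M(K); in particular \<open>measures_on UNIV\<close> is M(K).\<close>

definition measures_on :: "'k::topological_space set \<Rightarrow> ('k set \<Rightarrow> real) set" where
  "measures_on F =
     {\<mu>. signed_borel_measure \<mu> \<and> regular_signed_measure \<mu> \<and> supp \<mu> \<subseteq> F}"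

definition measure_sphere :: "'k::topological_space set \<Rightarrow> ('k set \<Rightarrow> real) set" where
  "measure_sphere F = {\<mu> \<in> measures_on F. total_variation \<mu> UNIV = 1}"

text \<open>
  The weak* topology of M(F), the dual of C(F): the coarsest topology making
  \<open>\<mu> \<mapsto> \<integral>\<^sub>F g d\<mu>\<close> continuous for every continuous \<open>g\<close> on \<open>F\<close>. Only the values of \<open>g\<close>
  on \<open>F\<close> enter.
\<close>

definition weak_star :: "'k::topological_space set \<Rightarrow> ('k set \<Rightarrow> real) topology" where
  "weak_star F = topology_generated_by
     {{\<mu> \<in> measures_on F. signed_integral \<mu> (\<lambda>y. if y \<in> F then g y else 0) \<in> U} | g U.
        continuous_on F g \<and> open U}"

definition weak_star_sphere :: "'k::topological_space set \<Rightarrow> ('k set \<Rightarrow> real) topology" where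
  "weak_star_sphere F = subtopology (weak_star F) (measure_sphere F)"

end

theory Submission
  imports Defs
begin

text \<open>
  Write \<open>K\<close> and \<open>L\<close> for the two compact spaces. Since \<open>T\<close> is an isometry onto \<open>E\<close>, the map
  \<open>Q = T\<^sup>-\<^sup>1 \<circ> P\<close> is linear of norm at most 1 with \<open>Q \<circ> T = id\<close>. For \<open>x\<close> in \<open>L\<close> the functional
  \<open>g \<mapsto> Q g x\<close> has norm at most 1 and takes the value 1 at \<open>h = T 1\<close>, a function in the unit ball; so
  it attains its norm there. The measure \<open>\<phi> x\<close> is the one that represents this functional.

  Norm attainment makes the signed measures tractable. The functional \<open>f \<mapsto> Q (h f) x\<close> is positive
  and unital, hence given by a regular Borel probability measure \<open>M x\<close>, and the original
  functional is integration against \<open>h\<close> with respect to \<open>M x\<close>, with \<open>\<bar>h\<bar> = 1\<close> almost everywhere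
  (\<open>norm_attaining_functional_representation\<close>). Thus the total variation of \<open>\<phi> x\<close> is \<open>M x\<close>, its
  Jordan decomposition is the restriction of \<open>M x\<close> to \<open>{y. h y = 1}\<close> and \<open>{y. h y = -1}\<close>, and only
  the positive case of the Riesz representation theorem is needed. That case is proved in the
  locale \<open>positive_unital_functional\<close>: the masses of open sets are suprema of the functional, they
  define an outer measure, the open sets satisfy Caratheodory's criterion, and a layer-cake
  estimate identifies the integral.

  If \<open>k\<close> is in the unit ball with \<open>k x = 1\<close>, then \<open>h T k\<close> has integral 1 with respect to \<open>M x\<close>, so
  \<open>\<bar>T k\<bar> = 1\<close> almost everywhere. A point \<open>y\<close> at which this holds for all such \<open>k\<close> has the property that
  \<open>f \<mapsto> T f y\<close> is evaluation at \<open>x\<close> up to sign (\<open>abs_functional_eq_abs_eval\<close>). So \<open>M x\<close> is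
  concentrated on the closed set \<open>G x\<close> of these points (\<open>representing_measure_concentrated\<close>), which is
  in particular nonempty. Let \<open>F\<close> be the union of all \<open>G x\<close>, let \<open>\<rho> y\<close> be the unique \<open>x\<close> with
  \<open>y \<in> G x\<close>, and let \<open>\<sigma>\<close> be the restriction of \<open>h\<close> to \<open>F\<close>. Then \<open>T f y = \<sigma> y f (\<rho> y)\<close> on \<open>F\<close> by
  construction, and \<open>f = Q g\<close> gives the formula for \<open>P g = T (Q g)\<close>. The map \<open>\<phi>\<close> is weak* continuous
  because \<open>x \<mapsto> Q g x\<close> is continuous for each \<open>g\<close> (\<open>continuous_map_weak_star_sphere\<close>).
\<close>

section \<open>Riesz representation of positive functionals\<close>

lemma normal_space_compact_t2:
  assumes "compact (UNIV :: 'k::t2_space set)"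
  shows "normal_space (euclidean :: 'k topology)"
proof (rule compact_Hausdorff_or_regular_imp_normal_space)
  show "compact_space (euclidean :: 'k topology)"
    using assms by (simp add: compact_space_def)
  have "Hausdorff_space (euclidean :: 'k topology)"
    unfolding Hausdorff_space_def using hausdorff[where 'a='k] by (auto simp: disjnt_def)
  then show "Hausdorff_space (euclidean :: 'k topology) \<or> regular_space (euclidean :: 'k topology)" ..
qed

lemma Urysohn_compact_t2:
  fixes S T :: "'k::t2_space set"
  assumes "compact (UNIV :: 'k set)" "closed S" "closed T" "S \<inter> T = {}"
  obtains f :: "'k \<Rightarrow> real" where "continuous_on UNIV f" "\<And>y. 0 \<le> f y" "\<And>y. f y \<le> 1"
    "\<And>y. y \<in> S \<Longrightarrow> f y = 0" "\<And>y. y \<in> T \<Longrightarrow> f y = 1"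
proof -
  obtain f :: "'k \<Rightarrow> real" where f: "continuous_map euclidean (top_of_set {0..1}) f"
      "f ` S \<subseteq> {0}" "f ` T \<subseteq> {1}"
    using Urysohn_lemma[OF normal_space_compact_t2[OF assms(1)], of S T 0 1] assms
    by (auto simp: disjnt_def)
  show thesis
    using f by (intro that[of f]) (auto simp: continuous_map_in_subtopology Pi_iff)
qed

text \<open>
  A positive functional on the continuous functions, taken on plain functions rather than on the
  type of bounded continuous functions, so that truncations, products and lattice operations can be
  written pointwise.
\<close>

locale positive_unital_functional =
  fixes \<Lambda> :: "('k::t2_space \<Rightarrow> real) \<Rightarrow> real"
  assumes compact_UNIV: "compact (UNIV :: 'k set)"
    and add: "continuous_on UNIV f \<Longrightarrow> continuous_on UNIV g \<Longrightarrow>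
      \<Lambda> (\<lambda>y. f y + g y) = \<Lambda> f + \<Lambda> g"
    and scale: "continuous_on UNIV f \<Longrightarrow> \<Lambda> (\<lambda>y. c * f y) = c * \<Lambda> f"
    and nonneg: "continuous_on UNIV f \<Longrightarrow> (\<And>y. 0 \<le> f y) \<Longrightarrow> 0 \<le> \<Lambda> f"
    and one: "\<Lambda> (\<lambda>_. 1) = 1"
begin

lemma diff:
  assumes "continuous_on UNIV f" "continuous_on UNIV g"
  shows "\<Lambda> (\<lambda>y. f y - g y) = \<Lambda> f - \<Lambda> g"
proof -
  have "\<Lambda> (\<lambda>y. (f y - g y) + g y) = \<Lambda> (\<lambda>y. f y - g y) + \<Lambda> g"
    using assms by (intro add continuous_intros)
  then show ?thesis by simp
qed

lemma mono:
  assumes "continuous_on UNIV f" "continuous_on UNIV g" "\<And>y. f y \<le> g y"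
  shows "\<Lambda> f \<le> \<Lambda> g"
  using nonneg[of "\<lambda>y. g y - f y"] diff[of g f] assms by (auto intro!: continuous_intros)

lemma const: "\<Lambda> (\<lambda>_. c) = c"
  using scale[of "\<lambda>_. 1" c] one by simp

lemma sum:
  assumes "\<And>i. i < n \<Longrightarrow> continuous_on UNIV (f i)"
  shows "\<Lambda> (\<lambda>y. \<Sum>i<n. f i y) = (\<Sum>i<(n::nat). \<Lambda> (f i))"
  using assms
proof (induction n)
  case 0
  then show ?case using const[of 0] by simp
next
  case (Suc n)
  have "continuous_on UNIV (\<lambda>y. \<Sum>i<n. f i y)"
    by (intro continuous_on_sum Suc.prems) simp
  then show ?case
    using add[of "\<lambda>y. \<Sum>i<n. f i y" "f n"] Suc by simp
qed

text \<open>
  The candidates \<open>f\<close> in the definition of the mass of an open set \<open>U\<close> only have to vanish off \<open>U\<close>, instead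
  of having their support inside \<open>U\<close>. The supremum is the same, because \<open>max 0 (f - e)\<close> has
  its support in \<open>{y. e \<le> f y} \<subseteq> U\<close> and differs from \<open>f\<close> by at most \<open>e\<close>.
\<close>

definition cutoffs :: "'k set \<Rightarrow> ('k \<Rightarrow> real) set" where
  "cutoffs U = {f. continuous_on UNIV f \<and> (\<forall>y. 0 \<le> f y \<and> f y \<le> 1) \<and> (\<forall>y. y \<notin> U \<longrightarrow> f y = 0)}"

definition open_mass :: "'k set \<Rightarrow> ennreal" where
  "open_mass U = (SUP f\<in>cutoffs U. ennreal (\<Lambda> f))"

definition outer_mass :: "'k set \<Rightarrow> ennreal" where
  "outer_mass A = (INF U\<in>{U. open U \<and> A \<subseteq> U}. open_mass U)"

lemma cutoffsD:
  assumes "f \<in> cutoffs U"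
  shows "continuous_on UNIV f" "0 \<le> f y" "f y \<le> 1" "y \<notin> U \<Longrightarrow> f y = 0" "0 \<le> \<Lambda> f" "\<Lambda> f \<le> 1"
  using assms nonneg[of f] mono[of f "\<lambda>_. 1"] one by (auto simp: cutoffs_def)

lemma zero_cutoff: "(\<lambda>_. 0) \<in> cutoffs U"
  by (simp add: cutoffs_def)

lemma open_mass_upper: "f \<in> cutoffs U \<Longrightarrow> ennreal (\<Lambda> f) \<le> open_mass U"
  unfolding open_mass_def by (rule SUP_upper)

lemma open_mass_mono: "U \<subseteq> V \<Longrightarrow> open_mass U \<le> open_mass V"
  unfolding open_mass_def by (rule SUP_subset_mono) (auto simp: cutoffs_def)

lemma open_mass_empty: "open_mass {} = 0"
proof -
  have "cutoffs {} = {\<lambda>_. 0}"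
    by (auto simp: cutoffs_def fun_eq_iff)
  then show ?thesis
    using const[of 0] by (simp add: open_mass_def)
qed

lemma open_mass_UNIV: "open_mass UNIV = 1"
proof (rule antisym)
  show "open_mass UNIV \<le> 1"
    unfolding open_mass_def by (rule SUP_least) (auto dest: cutoffsD(6))
  have "(\<lambda>_. 1) \<in> cutoffs UNIV"
    by (simp add: cutoffs_def)
  from open_mass_upper[OF this] show "1 \<le> open_mass UNIV"
    using one by simp
qed

text \<open>
  This replaces an open set by a smaller one that contains a superlevel set of \<open>f\<close>, at a cost of
  \<open>e\<close>. The superlevel sets \<open>{y. e \<le> f y}\<close> are compact, so that countable unions reduce to finite
  ones.
\<close>

lemma shift_down_cutoff:
  assumes "f \<in> cutoffs U" "0 \<le> e" "\<And>y. f y > e \<Longrightarrow> y \<in> V"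
  shows "(\<lambda>y. max 0 (f y - e)) \<in> cutoffs V" "\<Lambda> f \<le> \<Lambda> (\<lambda>y. max 0 (f y - e)) + e"
proof -
  note f = cutoffsD[OF assms(1)]
  show "(\<lambda>y. max 0 (f y - e)) \<in> cutoffs V"
    unfolding cutoffs_def
  proof (safe intro!: continuous_intros f(1))
    fix y
    show "max 0 (f y - e) \<le> 1"
      using f(3)[of y] \<open>0 \<le> e\<close> by simp
    assume "y \<notin> V"
    then show "max 0 (f y - e) = 0"
      using assms(3)[of y] by force
  qed simp
  have "\<Lambda> f \<le> \<Lambda> (\<lambda>y. max 0 (f y - e) + e)"
    by (rule mono) (auto intro!: continuous_intros f(1))
  also have "\<dots> = \<Lambda> (\<lambda>y. max 0 (f y - e)) + e"
    by (subst add) (auto intro!: continuous_intros f(1) simp: const)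
  finally show "\<Lambda> f \<le> \<Lambda> (\<lambda>y. max 0 (f y - e)) + e" .
qed

text \<open>
  A candidate \<open>f\<close> for \<open>U \<union> V\<close> is split as \<open>f \<le> g + k + e\<close> with candidates \<open>g\<close> for \<open>U\<close> and \<open>k\<close>
  for \<open>V\<close>. Here \<open>k = f h\<close> with \<open>h\<close> from Urysohn's lemma equal to 1 on the closed set
  \<open>{y. e \<le> f y} - U\<close>, which lies in \<open>V\<close>; what remains of \<open>f\<close> off \<open>U\<close> is then below \<open>e\<close>.
\<close>

lemma open_mass_Un:
  assumes "open U" "open V"
  shows "open_mass (U \<union> V) \<le> open_mass U + open_mass V"
proof (rule ennreal_le_epsilon)
  fix e :: real assume e: "0 < e"
  have "ennreal (\<Lambda> f) \<le> open_mass U + open_mass V + e" if fc: "f \<in> cutoffs (U \<union> V)" for f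
  proof -
    note f = cutoffsD[OF fc]
    have "closed {y. e \<le> f y}"
      by (intro closed_Collect_le f(1) continuous_on_const)
    then have cl: "closed ({y. e \<le> f y} - U)"
      using \<open>open U\<close> by (rule closed_Diff)
    have "- V \<inter> ({y. e \<le> f y} - U) = {}"
      using f(4) e by fastforce
    then obtain h where h: "continuous_on UNIV h" "\<And>y. 0 \<le> h y" "\<And>y. h y \<le> 1"
        "\<And>y. y \<in> - V \<Longrightarrow> h y = (0::real)" "\<And>y. y \<in> {y. e \<le> f y} - U \<Longrightarrow> h y = 1"
      using Urysohn_compact_t2[OF compact_UNIV _ cl, of "- V"] \<open>open V\<close> by auto
    define k where "k = (\<lambda>y. f y * h y)"
    define g where "g = (\<lambda>y. max 0 (f y - k y - e))"
    have k_le: "0 \<le> k y" "k y \<le> f y" for y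
      using f(2)[of y] h(2,3)[of y] by (auto simp: k_def mult_left_le)
    have contk: "continuous_on UNIV k" and contg: "continuous_on UNIV g"
      unfolding k_def g_def by (auto intro!: continuous_intros f(1) h(1))
    have k: "k \<in> cutoffs V"
      unfolding cutoffs_def
    proof (safe intro!: contk k_le(1))
      fix y
      show "k y \<le> 1"
        using k_le(2)[of y] f(3)[of y] by simp
      assume "y \<notin> V"
      then show "k y = 0"
        using h(4)[of y] by (simp add: k_def)
    qed
    have g: "g \<in> cutoffs U"
      unfolding cutoffs_def
    proof (safe intro!: contg)
      fix y
      show "g y \<le> 1"
        using k_le[of y] f(3)[of y] e by (simp add: g_def)
      assume "y \<notin> U"
      then show "g y = 0"
        using h(5)[of y] k_le[of y] e by (cases "e \<le> f y") (auto simp: g_def k_def)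
    qed (simp add: g_def)
    have "\<Lambda> f \<le> \<Lambda> (\<lambda>y. (g y + k y) + e)"
      by (rule mono) (auto intro!: continuous_intros f(1) contg contk simp: g_def)
    also have "\<dots> = \<Lambda> g + \<Lambda> k + e"
      using add[of "\<lambda>y. g y + k y" "\<lambda>_. e"] add[of g k] contg contk
      by (simp add: const continuous_on_add)
    finally have "ennreal (\<Lambda> f) \<le> ennreal (\<Lambda> g) + ennreal (\<Lambda> k) + ennreal e"
      using cutoffsD(5)[OF g] cutoffsD(5)[OF k] e by (simp flip: ennreal_plus)
    also have "\<dots> \<le> open_mass U + open_mass V + e"
      by (intro add_mono open_mass_upper g k order_refl)
    finally show ?thesis .
  qed
  then show "open_mass (U \<union> V) \<le> open_mass U + open_mass V + e"
    unfolding open_mass_def[of "U \<union> V"] by (rule SUP_least)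
qed

lemma open_mass_UN_lessThan:
  assumes "\<And>i::nat. open (U i)"
  shows "open_mass (\<Union>i<n. U i) \<le> (\<Sum>i<n. open_mass (U i))"
proof (induction n)
  case 0
  then show ?case by (simp add: open_mass_empty)
next
  case (Suc n)
  have "open_mass (\<Union>i<Suc n. U i) = open_mass ((\<Union>i<n. U i) \<union> U n)"
    by (simp add: lessThan_Suc Un_commute)
  also have "\<dots> \<le> open_mass (\<Union>i<n. U i) + open_mass (U n)"
    by (intro open_mass_Un open_UN ballI assms)
  also have "\<dots> \<le> (\<Sum>i<Suc n. open_mass (U i))"
    using Suc.IH by (simp add: add_right_mono)
  finally show ?case .
qed

lemma open_mass_UN:
  assumes U: "\<And>i::nat. open (U i)"
  shows "open_mass (\<Union>i. U i) \<le> (\<Sum>i. open_mass (U i))"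
proof (rule ennreal_le_epsilon)
  fix e :: real assume e: "0 < e"
  have "ennreal (\<Lambda> f) \<le> (\<Sum>i. open_mass (U i)) + e" if fc: "f \<in> cutoffs (\<Union>i. U i)" for f
  proof -
    note f = cutoffsD[OF fc]
    have "closed {y. e \<le> f y}"
      by (intro closed_Collect_le f(1) continuous_on_const)
    then have "compact {y. e \<le> f y}"
      using compact_UNIV compact_Int_closed by fastforce
    moreover have "{y. e \<le> f y} \<subseteq> (\<Union>i. U i)"
      using f(4) e by force
    ultimately obtain I where I: "finite I" "{y. e \<le> f y} \<subseteq> (\<Union>i\<in>I. U i)"
      using compactE_image[of _ UNIV U] U by metis
    then obtain n where n: "I \<subseteq> {..<n}"
      using finite_nat_iff_bounded by blast
    have sub: "y \<in> (\<Union>i<n. U i)" if "f y > e" for y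
    proof -
      have "y \<in> (\<Union>i\<in>I. U i)"
        using that by (intro subsetD[OF I(2)]) simp
      then show ?thesis
        using n by blast
    qed
    have "\<Lambda> f \<le> \<Lambda> (\<lambda>y. max 0 (f y - e)) + e"
      and c: "(\<lambda>y. max 0 (f y - e)) \<in> cutoffs (\<Union>i<n. U i)"
      using shift_down_cutoff[OF fc less_imp_le[OF e] sub] by auto
    then have "ennreal (\<Lambda> f) \<le> ennreal (\<Lambda> (\<lambda>y. max 0 (f y - e))) + ennreal e"
      using cutoffsD(5)[OF c] e by (simp flip: ennreal_plus)
    also have "\<dots> \<le> (\<Sum>i<n. open_mass (U i)) + e"
      by (intro add_mono order_refl order_trans[OF open_mass_upper[OF c] open_mass_UN_lessThan] U)
    also have "\<dots> \<le> (\<Sum>i. open_mass (U i)) + e"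
      by (intro add_mono order_refl sum_le_suminf) auto
    finally show ?thesis .
  qed
  then show "open_mass (\<Union>i. U i) \<le> (\<Sum>i. open_mass (U i)) + e"
    unfolding open_mass_def[of "\<Union>i. U i"] by (rule SUP_least)
qed

lemma outer_mass_open: "open U \<Longrightarrow> outer_mass U = open_mass U"
  unfolding outer_mass_def by (rule antisym) (auto intro: INF_lower INF_greatest open_mass_mono)

lemma outer_mass_mono: "A \<subseteq> B \<Longrightarrow> outer_mass A \<le> outer_mass B"
  unfolding outer_mass_def by (rule INF_superset_mono) auto

lemma outer_mass_UN: "outer_mass (\<Union>i::nat. A i) \<le> (\<Sum>i. outer_mass (A i))"
proof (rule ennreal_le_epsilon)
  fix e :: real assume e: "0 < e" and fin: "(\<Sum>i. outer_mass (A i)) < top"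
  have "\<exists>U. open U \<and> A i \<subseteq> U \<and> open_mass U \<le> outer_mass (A i) + e * (1/2) ^ Suc i" for i
  proof -
    have "outer_mass (A i) < outer_mass (A i) + e * (1/2) ^ Suc i"
      using fin e by (auto simp add: less_top dest!: ennreal_suminf_lessD)
    then obtain U where "open U" "A i \<subseteq> U" "open_mass U < outer_mass (A i) + e * (1/2) ^ Suc i"
      unfolding outer_mass_def[of "A i"] INF_less_iff by auto
    then show ?thesis by (auto intro: less_imp_le)
  qed
  then obtain U where U: "\<And>i. open (U i)" "\<And>i. A i \<subseteq> U i"
      "\<And>i. open_mass (U i) \<le> outer_mass (A i) + e * (1/2) ^ Suc i"
    by metis
  have "outer_mass (\<Union>i. A i) \<le> outer_mass (\<Union>i. U i)"
    using U(2) by (intro outer_mass_mono) blast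
  also have "\<dots> \<le> (\<Sum>i. open_mass (U i))"
    using U(1) by (simp add: outer_mass_open open_UN open_mass_UN)
  also have "\<dots> \<le> (\<Sum>i. outer_mass (A i) + ennreal e * ennreal ((1/2) ^ Suc i))"
    using U(3) e by (intro suminf_le) (auto simp: ennreal_mult[symmetric])
  also have "\<dots> = (\<Sum>i. outer_mass (A i)) + (\<Sum>i. ennreal e * ennreal ((1/2) ^ Suc i))"
    by (rule suminf_add[symmetric]) auto
  also have "(\<Sum>i. ennreal e * ennreal ((1/2) ^ Suc i)) = ennreal e"
    unfolding ennreal_suminf_cmult
    by (subst suminf_ennreal_eq[OF zero_le_power power_half_series]) auto
  finally show "outer_mass (\<Union>i. A i) \<le> (\<Sum>i. outer_mass (A i)) + e" .
qed

lemma outer_measure_space_outer_mass: "outer_measure_space UNIV outer_mass"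
  unfolding outer_measure_space_def positive_def increasing_def countably_subadditive_def
  by (auto simp: outer_mass_open open_mass_empty outer_mass_mono outer_mass_UN)

lemma outer_mass_Un: "outer_mass (A \<union> B) \<le> outer_mass A + outer_mass B"
proof -
  have "outer_mass (A \<union> B) \<le> (\<Sum>i. outer_mass (binaryset A B i))"
    using outer_mass_UN[of "binaryset A B"] by (simp add: UN_binaryset_eq)
  also have "\<dots> = outer_mass A + outer_mass B"
    by (intro suminf_binaryset_eq) (simp add: outer_mass_open open_mass_empty)
  finally show ?thesis .
qed

text \<open>
  Caratheodory's criterion for an open set \<open>V\<close>, tested on open sets \<open>U\<close>. Given a candidate \<open>f\<close> for
  \<open>U \<inter> V\<close>, the open set \<open>W = {y \<in> U. f y < e}\<close> contains \<open>U - V\<close>, and \<open>max 0 (f - e)\<close> lives off \<open>W\<close>,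
  so adding to it any candidate for \<open>W\<close> gives a candidate for \<open>U\<close>.
\<close>

lemma open_mass_split:
  assumes "open U" "open V"
  shows "open_mass (U \<inter> V) + outer_mass (U - V) \<le> open_mass U"
proof (rule ennreal_le_epsilon)
  fix e :: real assume e: "0 < e"
  have "ennreal (\<Lambda> f) + outer_mass (U - V) \<le> open_mass U + e" if fc: "f \<in> cutoffs (U \<inter> V)" for f
  proof -
    note f = cutoffsD[OF fc]
    define W where "W = U \<inter> {y. f y < e}"
    define k where "k = (\<lambda>y. max 0 (f y - e))"
    have "open W"
      unfolding W_def by (intro open_Int assms open_Collect_less f(1) continuous_on_const)
    moreover have "U - V \<subseteq> W"
      using f(4) e by (auto simp: W_def)
    ultimately have 1: "outer_mass (U - V) \<le> open_mass W"
      unfolding outer_mass_def by (intro INF_lower) auto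
    have "f y > e \<Longrightarrow> y \<in> U" for y
      using f(4)[of y] e by force
    from shift_down_cutoff[OF fc less_imp_le[OF e] this]
    have k: "k \<in> cutoffs U" "\<Lambda> f \<le> \<Lambda> k + e"
      by (auto simp: k_def)
    have 2: "ennreal (\<Lambda> f) + ennreal (\<Lambda> g) \<le> open_mass U + e" if gc: "g \<in> cutoffs W" for g
    proof -
      note g = cutoffsD[OF gc]
      have "(\<lambda>y. k y + g y) \<in> cutoffs U"
        unfolding cutoffs_def
      proof (safe intro!: continuous_intros cutoffsD(1)[OF k(1)] g(1))
        fix y
        show "0 \<le> k y + g y"
          using g(2)[of y] by (simp add: k_def)
        show "k y + g y \<le> 1"
          using g(2,3,4)[of y] f(3)[of y] e by (cases "f y < e") (auto simp: k_def W_def)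
        assume "y \<notin> U"
        then show "k y + g y = 0"
          using g(4)[of y] cutoffsD(4)[OF k(1), of y] by (simp add: W_def)
      qed
      from open_mass_upper[OF this]
      have "ennreal (\<Lambda> k + \<Lambda> g) \<le> open_mass U"
        using add[OF cutoffsD(1)[OF k(1)] g(1)] by simp
      then have "ennreal (\<Lambda> k + \<Lambda> g) + ennreal e \<le> open_mass U + ennreal e"
        by (rule add_right_mono)
      moreover have "ennreal (\<Lambda> f) + ennreal (\<Lambda> g) \<le> ennreal (\<Lambda> k + \<Lambda> g) + ennreal e"
        using k(2) f(5) g(5) cutoffsD(5)[OF k(1)] e by (simp flip: ennreal_plus)
      ultimately show ?thesis by (rule order_trans[rotated])
    qed
    have "ennreal (\<Lambda> f) + outer_mass (U - V) \<le> ennreal (\<Lambda> f) + open_mass W"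
      by (intro add_left_mono 1)
    also have "\<dots> = (SUP g\<in>cutoffs W. ennreal (\<Lambda> f) + ennreal (\<Lambda> g))"
      unfolding open_mass_def using zero_cutoff by (intro ennreal_SUP_add_right) auto
    also have "\<dots> \<le> open_mass U + e"
      by (intro SUP_least 2)
    finally show ?thesis .
  qed
  moreover have "open_mass (U \<inter> V) + outer_mass (U - V)
      = (SUP f\<in>cutoffs (U \<inter> V). ennreal (\<Lambda> f) + outer_mass (U - V))"
    unfolding open_mass_def[of "U \<inter> V"] using zero_cutoff by (intro ennreal_SUP_add_left[symmetric]) auto
  ultimately show "open_mass (U \<inter> V) + outer_mass (U - V) \<le> open_mass U + e"
    by (auto intro: SUP_least)
qed

lemma open_in_lambda_system:
  assumes V: "open V"
  shows "V \<in> lambda_system UNIV UNIV outer_mass"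
proof -
  have "outer_mass (V \<inter> A) + outer_mass ((UNIV - V) \<inter> A) = outer_mass A" for A
  proof (rule antisym)
    show "outer_mass (V \<inter> A) + outer_mass ((UNIV - V) \<inter> A) \<le> outer_mass A"
      unfolding outer_mass_def[of A]
    proof (rule INF_greatest)
      fix U assume "U \<in> {U. open U \<and> A \<subseteq> U}"
      then have U: "open U" "A \<subseteq> U" by auto
      have "outer_mass (V \<inter> A) \<le> open_mass (U \<inter> V)"
        unfolding outer_mass_def using U V by (intro INF_lower) auto
      moreover have "outer_mass ((UNIV - V) \<inter> A) \<le> outer_mass (U - V)"
        using U by (intro outer_mass_mono) auto
      ultimately show "outer_mass (V \<inter> A) + outer_mass ((UNIV - V) \<inter> A) \<le> open_mass U"
        using open_mass_split[OF U(1) V] by (meson add_mono order_trans)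
    qed
    have "(V \<inter> A) \<union> ((UNIV - V) \<inter> A) = A" by auto
    then show "outer_mass A \<le> outer_mass (V \<inter> A) + outer_mass ((UNIV - V) \<inter> A)"
      using outer_mass_Un[of "V \<inter> A" "(UNIV - V) \<inter> A"] by simp
  qed
  then show ?thesis
    by (simp add: lambda_system_def)
qed

definition representing_measure :: "'k measure" where
  "representing_measure = measure_of UNIV (sets borel) outer_mass"

lemma sets_representing_measure [simp, measurable_cong]:
  "sets representing_measure = sets borel"
  unfolding representing_measure_def
  using sets.sigma_sets_eq[of "borel :: 'k measure"] by (simp add: sets_measure_of)

lemma space_representing_measure [simp]: "space representing_measure = UNIV"
  using sets_eq_imp_space_eq[OF sets_representing_measure] by simp

lemma emeasure_representing_measure:
  assumes "A \<in> sets borel"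
  shows "emeasure representing_measure A = outer_mass A"
proof -
  interpret P: sigma_algebra "UNIV :: 'k set" "UNIV :: 'k set set"
    using sigma_algebra_Pow[of "UNIV :: 'k set"] by simp
  have ms: "measure_space UNIV (lambda_system UNIV UNIV outer_mass) outer_mass"
    by (rule P.caratheodory_lemma[OF outer_measure_space_outer_mass])
  then interpret L: sigma_algebra "UNIV :: 'k set" "lambda_system UNIV UNIV outer_mass"
    by (simp add: measure_space_def)
  have sub: "sets (borel :: 'k measure) \<subseteq> lambda_system UNIV UNIV outer_mass"
    unfolding sets_borel by (rule L.sigma_sets_subset) (auto intro: open_in_lambda_system)
  show ?thesis
    unfolding representing_measure_def
  proof (rule emeasure_measure_of_sigma)
    show "sigma_algebra UNIV (sets (borel :: 'k measure))"
      using sets.sigma_algebra_axioms[of "borel :: 'k measure"] by simp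
    show "positive (sets borel) outer_mass"
      by (simp add: positive_def outer_mass_open open_mass_empty)
    show "countably_additive (sets borel) outer_mass"
      using ms sub unfolding measure_space_def countably_additive_def by blast
  qed fact
qed

lemma emeasure_representing_measure_UNIV: "emeasure representing_measure UNIV = 1"
  by (simp add: emeasure_representing_measure outer_mass_open open_mass_UNIV)

lemma finite_measure_representing_measure: "finite_measure representing_measure"
  by (rule finite_measureI) (simp add: emeasure_representing_measure_UNIV)

lemma outer_regular_representing_measure:
  assumes "A \<in> sets borel"
  shows "emeasure representing_measure A
    = (INF U\<in>{U. A \<subseteq> U \<and> open U}. emeasure representing_measure U)"
proof -
  have "(INF U\<in>{U. A \<subseteq> U \<and> open U}. emeasure representing_measure U)
      = (INF U\<in>{U. open U \<and> A \<subseteq> U}. open_mass U)"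
    by (intro INF_cong) (auto simp: emeasure_representing_measure outer_mass_open)
  then show ?thesis
    by (simp add: emeasure_representing_measure assms outer_mass_def)
qed

text \<open>
  Outer regularity holds by construction; inner regularity follows by applying it to the complement,
  because the measure is finite and the closed sets are the compact ones.
\<close>

lemma inner_regular_representing_measure:
  assumes A: "A \<in> sets borel"
  shows "emeasure representing_measure A
    = (SUP C\<in>{C. C \<subseteq> A \<and> compact C}. emeasure representing_measure C)"
proof (rule antisym)
  let ?M = "representing_measure"
  interpret finite_measure ?M by (rule finite_measure_representing_measure)
  have compl: "measure ?M B = 1 - measure ?M (- B)" if "B \<in> sets borel" for B
    using finite_measure_compl[of "- B"] that emeasure_representing_measure_UNIV
    by (simp add: measure_def Compl_eq_Diff_UNIV[symmetric])
  show "emeasure ?M A \<le> (SUP C\<in>{C. C \<subseteq> A \<and> compact C}. emeasure ?M C)"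
  proof (rule ennreal_le_epsilon)
    fix e :: real assume e: "0 < e"
    have "emeasure ?M (- A) < emeasure ?M (- A) + e"
      using e by (simp add: emeasure_eq_measure ennreal_less_iff flip: ennreal_plus)
    then obtain U where U: "open U" "- A \<subseteq> U" "emeasure ?M U < emeasure ?M (- A) + e"
      using A unfolding outer_regular_representing_measure[OF borel_comp[OF A]] INF_less_iff by auto
    have "compact (- U)"
      using U(1) compact_UNIV compact_Int_closed[of UNIV "- U"] by auto
    then have "emeasure ?M (- U) \<le> (SUP C\<in>{C. C \<subseteq> A \<and> compact C}. emeasure ?M C)"
      using U(2) by (intro SUP_upper) auto
    moreover have "measure ?M A \<le> measure ?M (- U) + e"
      using U e compl[OF A] compl[of "- U"]
      by (simp add: emeasure_eq_measure ennreal_less_iff flip: ennreal_plus)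
    then have "emeasure ?M A \<le> emeasure ?M (- U) + e"
      using e by (simp add: emeasure_eq_measure flip: ennreal_plus)
    ultimately show "emeasure ?M A \<le> (SUP C\<in>{C. C \<subseteq> A \<and> compact C}. emeasure ?M C) + e"
      by (meson add_right_mono order_trans)
  qed
  show "(SUP C\<in>{C. C \<subseteq> A \<and> compact C}. emeasure ?M C) \<le> emeasure ?M A"
    using A by (intro SUP_least emeasure_mono) auto
qed

lemma integrable_representing_measure:
  assumes f: "continuous_on UNIV (f :: 'k \<Rightarrow> real)"
  shows "integrable representing_measure f"
proof -
  interpret finite_measure representing_measure by (rule finite_measure_representing_measure)
  have "bounded (range f)"
    using compact_continuous_image[OF f compact_UNIV] by (rule compact_imp_bounded)
  then obtain B where "\<And>y. norm (f y) \<le> B"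
    by (auto simp: bounded_iff)
  then show ?thesis
    using borel_measurable_continuous_onI[OF f]
    by (intro integrable_const_bound[of _ B]) (auto simp: measurable_cong_sets[OF sets_representing_measure refl])
qed

text \<open>
  Layer-cake estimate. For \<open>0 \<le> f \<le> 1\<close> the function \<open>N f\<close> is the sum of the slices
  \<open>s k = min 1 (max 0 (N f - k))\<close>, \<open>k < N\<close>. Each slice is a candidate for the open set
  \<open>U k = {y. k < N f y}\<close>, so \<open>N \<Lambda> f\<close> is at most the integral of the function that counts the
  indices \<open>k\<close> with \<open>y \<in> U k\<close>. This count is at most \<open>N f y + 1\<close>; the error 1 disappears
  after division by \<open>N\<close>.
\<close>

lemma cutoff_le_integral:
  assumes fc: "f \<in> cutoffs UNIV"
  shows "\<Lambda> f \<le> (LINT y|representing_measure. f y)"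
proof -
  let ?M = "representing_measure"
  interpret finite_measure ?M by (rule finite_measure_representing_measure)
  note f = cutoffsD[OF fc]
  have slices: "(\<Sum>k<n. min 1 (max 0 (t - real k))) = min (real n) t" if "0 \<le> t" for n and t :: real
    using that by (induction n) (auto simp: min_def max_def)
  have count: "(\<Sum>k<n. indicator {s. real k < s} t) \<le> min (real n) (t + 1)" if "0 \<le> t" for n and t :: real
    using that by (induction n) (auto simp: indicator_def)
  have bound: "real N * \<Lambda> f \<le> real N * (LINT y|?M. f y) + 1" for N
  proof -
    define s where "s k y = min 1 (max 0 (real N * f y - real k))" for k y
    define U where "U k = {y. real k < real N * f y}" for k
    have conts: "continuous_on UNIV (s k)" for k
      unfolding s_def by (intro continuous_intros f(1))
    have openU: "open (U k)" for k
      unfolding U_def by (intro open_Collect_less continuous_intros f(1))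
    have s: "s k \<in> cutoffs (U k)" for k
      using conts[of k] by (auto simp: cutoffs_def s_def U_def)
    have le: "\<Lambda> (s k) \<le> measure ?M (U k)" for k
    proof -
      have "ennreal (\<Lambda> (s k)) \<le> emeasure ?M (U k)"
        using open_mass_upper[OF s[of k]] openU[of k]
        by (simp add: emeasure_representing_measure outer_mass_open)
      then show ?thesis
        by (simp add: emeasure_eq_measure)
    qed
    have "real N * f y = (\<Sum>k<N. s k y)" for y
      using slices[of "real N * f y" N] f(2,3)[of y]
      by (simp add: s_def mult_left_le)
    then have "real N * \<Lambda> f = (\<Sum>k<N. \<Lambda> (s k))"
      using scale[OF f(1), of "real N"] sum[of N s] conts by simp
    also have "\<dots> \<le> (\<Sum>k<N. measure ?M (U k))"
      by (intro sum_mono le)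
    also have "\<dots> = (LINT y|?M. (\<Sum>k<N. indicator (U k) y))"
      using openU by (subst Bochner_Integration.integral_sum) (auto simp: integrable_indicator_iff emeasure_eq_measure)
    also have "\<dots> \<le> (LINT y|?M. real N * f y + 1)"
    proof (rule integral_mono)
      show "integrable ?M (\<lambda>y. \<Sum>k<N. indicator (U k) y :: real)"
        using openU by (intro Bochner_Integration.integrable_sum) (auto simp: integrable_indicator_iff emeasure_eq_measure)
      show "integrable ?M (\<lambda>y. real N * f y + 1)"
        by (intro integrable_representing_measure continuous_intros f(1))
      show "(\<Sum>k<N. indicator (U k) y) \<le> real N * f y + 1" for y
        using count[of "real N * f y" N] f(2)[of y] by (simp add: U_def indicator_def)
    qed
    also have "\<dots> = real N * (LINT y|?M. f y) + 1"
      using integrable_representing_measure[OF f(1)] emeasure_representing_measure_UNIV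
      by (simp add: measure_def)
    finally show ?thesis .
  qed
  show ?thesis
  proof (rule ccontr)
    assume "\<not> ?thesis"
    then have d: "0 < \<Lambda> f - (LINT y|?M. f y)" by simp
    obtain N where "1 < real N * (\<Lambda> f - (LINT y|?M. f y))"
      using reals_Archimedean3[OF d] by blast
    then show False
      using bound[of N] by (simp add: algebra_simps)
  qed
qed

lemma le_integral:
  assumes f: "continuous_on UNIV f"
  shows "\<Lambda> f \<le> (LINT y|representing_measure. f y)"
proof -
  interpret finite_measure representing_measure by (rule finite_measure_representing_measure)
  have "bounded (range f)"
    using compact_continuous_image[OF f compact_UNIV] by (rule compact_imp_bounded)
  then obtain B where B: "0 < B" "\<And>y. \<bar>f y\<bar> \<le> B"
    by (auto simp: bounded_pos)
  define g where "g = (\<lambda>y. (1 / (2 * B)) * (f y + B))"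
  have "0 \<le> g y" "g y \<le> 1" for y
    using B(1) B(2)[of y] by (auto simp: g_def field_simps)
  moreover have "continuous_on UNIV g"
    unfolding g_def by (intro continuous_intros f)
  ultimately have "g \<in> cutoffs UNIV"
    by (simp add: cutoffs_def)
  then have "\<Lambda> g \<le> (LINT y|representing_measure. g y)"
    by (rule cutoff_le_integral)
  moreover have "\<Lambda> g = (1 / (2 * B)) * (\<Lambda> f + B)"
    unfolding g_def using f by (subst scale) (auto simp: add const intro!: continuous_intros)
  moreover have "(LINT y|representing_measure. g y) = (1 / (2 * B)) * ((LINT y|representing_measure. f y) + B)"
    unfolding g_def using integrable_representing_measure[OF f] emeasure_representing_measure_UNIV
    by (simp add: measure_def)
  ultimately show ?thesis
    using B(1) by (simp add: field_simps)
qed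

text \<open>
  The one-sided estimate suffices: applied to \<open>f\<close> and to \<open>- f\<close> it gives both inequalities.
\<close>

theorem integral_representing_measure:
  assumes f: "continuous_on UNIV f"
  shows "(LINT y|representing_measure. f y) = \<Lambda> f"
  using le_integral[OF f] le_integral[of "\<lambda>y. - 1 * f y"] scale[OF f, of "- 1"] f
  by (simp add: continuous_on_minus)

end

section \<open>Signed measures with a unimodular density\<close>

definition regular_borel_probability :: "'k::topological_space measure \<Rightarrow> bool" where
  "regular_borel_probability M \<longleftrightarrow> sets M = sets borel \<and> emeasure M UNIV = 1 \<and>
     (\<forall>A\<in>sets borel.
        emeasure M A = (SUP C\<in>{C. C \<subseteq> A \<and> compact C}. emeasure M C) \<and>
        emeasure M A = (INF U\<in>{U. A \<subseteq> U \<and> open U}. emeasure M U))"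

lemma regular_borel_probabilityD:
  assumes "regular_borel_probability M"
  shows "sets M = sets borel" "emeasure M UNIV = 1" "space M = UNIV" "finite_measure M"
    "A \<in> sets borel \<Longrightarrow> emeasure M A = (SUP C\<in>{C. C \<subseteq> A \<and> compact C}. emeasure M C)"
    "A \<in> sets borel \<Longrightarrow> emeasure M A = (INF U\<in>{U. A \<subseteq> U \<and> open U}. emeasure M U)"
proof -
  show 1: "sets M = sets borel" and 2: "emeasure M UNIV = 1"
    "A \<in> sets borel \<Longrightarrow> emeasure M A = (SUP C\<in>{C. C \<subseteq> A \<and> compact C}. emeasure M C)"
    "A \<in> sets borel \<Longrightarrow> emeasure M A = (INF U\<in>{U. A \<subseteq> U \<and> open U}. emeasure M U)"
    using assms unfolding regular_borel_probability_def by blast+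
  show 3: "space M = UNIV"
    using sets_eq_imp_space_eq[OF 1] by simp
  show "finite_measure M"
    by (rule finite_measureI) (simp add: 2 3)
qed

text \<open>
  Local nullity implies nullity. This holds for uncountable covers, where countable additivity alone
  gives nothing, because inner regularity reduces it to compact sets and hence to finite covers.
\<close>

lemma regular_null_set_of_cover:
  fixes M :: "'k::t2_space measure"
  assumes M: "regular_borel_probability M" and B: "B \<in> sets borel"
    and null: "\<And>y. y \<in> B \<Longrightarrow> \<exists>V. open V \<and> y \<in> V \<and> emeasure M V = 0"
  shows "emeasure M B = 0"
proof -
  note M = regular_borel_probabilityD[OF M]
  have "emeasure M C = 0" if C: "C \<subseteq> B" "compact C" for C
  proof -
    obtain V where V: "\<And>y. y \<in> C \<Longrightarrow> open (V y) \<and> y \<in> V y \<and> emeasure M (V y) = 0"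
      using null C(1) by (meson subsetD)
    then obtain D where D: "D \<subseteq> C" "finite D" "C \<subseteq> (\<Union>y\<in>D. V y)"
      using compactE_image[OF C(2), of C V] by (metis UN_I subsetI)
    have "(\<Union>y\<in>D. V y) \<in> null_sets M"
      using V D by (intro null_sets.finite_UN) (auto simp: null_sets_def M(1))
    moreover have "C \<in> sets M"
      using C(2) M(1) by (simp add: borel_closed compact_imp_closed)
    ultimately show ?thesis
      using D(3) by (meson null_setsD1 null_sets_subset)
  qed
  then show ?thesis
    unfolding M(5)[OF B] by (auto intro!: antisym SUP_least)
qed

text \<open>
  The signed measure with density \<open>h\<close> with respect to \<open>M\<close>, for an \<open>h\<close> of absolute value 1 almost
  everywhere. Writing it with the two level sets of \<open>h\<close> instead of an integral makes its Jordan
  decomposition immediate: the level sets form a Hahn decomposition.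
\<close>

definition signed_by :: "'k::topological_space measure \<Rightarrow> ('k \<Rightarrow> real) \<Rightarrow> 'k set \<Rightarrow> real" where
  "signed_by M h A =
     (if A \<in> sets borel then measure M (A \<inter> {y. h y = 1}) - measure M (A \<inter> {y. h y = -1}) else 0)"

text \<open>
  The supremum in the upper variation of \<open>A\<close> is attained at \<open>A \<inter> {y. h y = 1}\<close>.
\<close>

lemma pos_part_signed_by:
  fixes M :: "'k::topological_space measure"
  assumes M: "sets M = sets borel" "finite_measure M" and h: "h \<in> borel_measurable borel"
  shows "pos_part (signed_by M h) = density M (indicator {y. h y = 1})"
proof -
  interpret finite_measure M by fact
  let ?P = "{y. h y = 1}" and ?N = "{y. h y = -1}"
  have P: "?P \<in> sets borel" and N: "?N \<in> sets borel"
    using h by measurable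
  have space: "space M = UNIV"
    using sets_eq_imp_space_eq[OF M(1)] by simp
  have *: "(SUP B\<in>{B \<in> sets borel. B \<subseteq> A}. ennreal (signed_by M h B))
      = emeasure (density M (indicator ?P)) A" if A: "A \<in> sets borel" for A
  proof -
    have "emeasure (density M (indicator ?P)) A = ennreal (measure M (A \<inter> ?P))"
      using P A by (simp add: emeasure_restricted M(1) Int_commute emeasure_eq_measure)
    moreover have "(SUP B\<in>{B \<in> sets borel. B \<subseteq> A}. ennreal (signed_by M h B))
        = ennreal (measure M (A \<inter> ?P))"
    proof (rule antisym)
      show "(SUP B\<in>{B \<in> sets borel. B \<subseteq> A}. ennreal (signed_by M h B)) \<le> ennreal (measure M (A \<inter> ?P))"
      proof (safe intro!: SUP_least ennreal_leI)
        fix B assume "B \<in> sets borel" "B \<subseteq> A"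
        then have "measure M (B \<inter> ?P) \<le> measure M (A \<inter> ?P)"
          using A P by (intro finite_measure_mono) (auto simp: M(1))
        moreover have "signed_by M h B \<le> measure M (B \<inter> ?P)"
          by (simp add: signed_by_def)
        ultimately show "signed_by M h B \<le> measure M (A \<inter> ?P)"
          by linarith
      qed
      have "A \<inter> ?P \<inter> ?P = A \<inter> ?P" "A \<inter> ?P \<inter> ?N = {}" by auto
      then have "signed_by M h (A \<inter> ?P) = measure M (A \<inter> ?P)"
        using A P by (simp add: signed_by_def)
      then show "ennreal (measure M (A \<inter> ?P)) \<le> (SUP B\<in>{B \<in> sets borel. B \<subseteq> A}. ennreal (signed_by M h B))"
        using A P by (intro SUP_upper2[of "A \<inter> ?P"]) auto
    qed
    ultimately show ?thesis by simp
  qed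
  have "pos_part (signed_by M h) = measure_of UNIV (sets borel) (emeasure (density M (indicator ?P)))"
    unfolding pos_part_def
    using * sets.sigma_sets_eq[of "borel :: 'k measure"] by (intro measure_of_eq) auto
  also have "\<dots> = density M (indicator ?P)"
    using measure_of_of_measure[of "density M (indicator ?P)"] by (simp add: M(1) space)
  finally show ?thesis .
qed

lemma neg_part_signed_by:
  fixes M :: "'k::topological_space measure"
  assumes "sets M = sets borel" "finite_measure M" "h \<in> borel_measurable borel"
  shows "neg_part (signed_by M h) = density M (indicator {y. h y = -1})"
proof -
  have swap: "- h y = 1 \<longleftrightarrow> h y = - 1" for y
    by linarith
  have "(\<lambda>A. - signed_by M h A) = signed_by M (\<lambda>y. - h y)"
    by (auto simp: signed_by_def fun_eq_iff swap)
  then show ?thesis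
    using pos_part_signed_by[OF assms(1,2), of "\<lambda>y. - h y"] assms(3)
    by (simp add: neg_part_def swap)
qed

lemma signed_borel_measure_signed_by:
  fixes M :: "'k::topological_space measure"
  assumes M: "sets M = sets borel" "finite_measure M" and h: "h \<in> borel_measurable borel"
  shows "signed_borel_measure (signed_by M h)"
  unfolding signed_borel_measure_def
proof (intro conjI allI impI)
  interpret finite_measure M by fact
  let ?P = "{y. h y = 1}" and ?N = "{y. h y = -1}"
  have P: "?P \<in> sets borel" and N: "?N \<in> sets borel"
    using h by measurable
  fix A :: "nat \<Rightarrow> 'k set" assume A: "range A \<subseteq> sets borel" "disjoint_family A"
  have "(\<lambda>i. measure M (A i \<inter> D)) sums measure M ((\<Union>i. A i) \<inter> D)" if "D \<in> sets borel" for D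
  proof -
    have "(\<Union>i. A i \<inter> D) = (\<Union>i. A i) \<inter> D" by auto
    moreover have "disjoint_family (\<lambda>i. A i \<inter> D)"
      using A(2) by (auto simp: disjoint_family_on_def)
    ultimately show ?thesis
      using finite_measure_UNION[of "\<lambda>i. A i \<inter> D"] A(1) that by (auto simp: M(1))
  qed
  from sums_diff[OF this[OF P] this[OF N]]
  show "(\<lambda>i. signed_by M h (A i)) sums signed_by M h (\<Union>i. A i)"
    using A(1) by (simp add: signed_by_def range_subsetD sets.countable_UN)
qed (simp add: signed_by_def)

lemma total_variation_signed_by:
  fixes M :: "'k::topological_space measure"
  assumes M: "sets M = sets borel" "finite_measure M" and h: "h \<in> borel_measurable borel"
    and h1: "AE y in M. \<bar>h y\<bar> = 1" and A: "A \<in> sets borel"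
  shows "total_variation (signed_by M h) A = emeasure M A"
proof -
  let ?P = "{y. h y = 1}" and ?N = "{y. h y = -1}"
  have P: "?P \<in> sets borel" and N: "?N \<in> sets borel"
    using h by measurable
  have "total_variation (signed_by M h) A = emeasure M (A \<inter> ?P) + emeasure M (A \<inter> ?N)"
    unfolding total_variation_def pos_part_signed_by[OF M h] neg_part_signed_by[OF M h]
    using P N A by (simp add: emeasure_restricted M(1) Int_commute)
  also have "\<dots> = emeasure M ((A \<inter> ?P) \<union> (A \<inter> ?N))"
    using P N A by (intro plus_emeasure) (auto simp: M(1))
  also have "\<dots> = emeasure M A"
    using P N A h1 by (intro emeasure_eq_AE) (auto simp: M(1) abs_if split: if_splits)
  finally show ?thesis .
qed

lemma signed_integral_signed_by:
  fixes M :: "'k::topological_space measure"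
  assumes M: "sets M = sets borel" "finite_measure M" and h: "h \<in> borel_measurable borel"
    and h1: "AE y in M. \<bar>h y\<bar> = 1" and g: "integrable M g"
  shows "signed_integral (signed_by M h) g = (LINT y|M. h y * g y)"
proof -
  let ?P = "{y. h y = 1}" and ?N = "{y. h y = -1}"
  have P: "?P \<in> sets M" and N: "?N \<in> sets M"
    using h unfolding M(1) by measurable
  have hM: "h \<in> borel_measurable M"
    using h by (simp add: measurable_cong_sets[OF M(1) refl])
  have eq: "(LINT y|density M (indicator D). g y) = (LINT y|M. indicator D y * g y)"
    if "D \<in> sets M" for D
    using integral_density[of g M "indicator D"] that g by (simp add: ennreal_indicator)
  have "signed_integral (signed_by M h) g
      = (LINT y|M. indicator ?P y * g y) - (LINT y|M. indicator ?N y * g y)"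
    unfolding signed_integral_def pos_part_signed_by[OF M h] neg_part_signed_by[OF M h]
    using P N by (simp add: eq)
  also have "\<dots> = (LINT y|M. indicator ?P y * g y - indicator ?N y * g y)"
    using integrable_mult_indicator[OF P g] integrable_mult_indicator[OF N g]
    by (intro Bochner_Integration.integral_diff[symmetric]) simp_all
  also have "\<dots> = (LINT y|M. h y * g y)"
    using P N hM g borel_measurable_integrable[OF g] h1
    by (intro integral_cong_AE) (auto simp: indicator_def abs_if split: if_splits)
  finally show ?thesis .
qed

text \<open>
  Since the total variation is \<open>M\<close>, regularity carries over from \<open>M\<close>. For the support, the
  intersection of all closed sets with null complement again has a null complement, because that
  complement is covered by null open sets; so the least such set exists.
\<close>

lemma signed_by_measures_on:
  fixes M :: "'k::t2_space measure"
  assumes M: "regular_borel_probability M" and h: "h \<in> borel_measurable borel"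
    and h1: "AE y in M. \<bar>h y\<bar> = 1"
  shows signed_by_regular: "regular_signed_measure (signed_by M h)"
    and supp_signed_by: "closed S \<Longrightarrow> emeasure M (- S) = 0 \<Longrightarrow> supp (signed_by M h) \<subseteq> S"
proof -
  note MD = regular_borel_probabilityD[OF M]
  note tv = total_variation_signed_by[OF MD(1,4) h h1]
  show "regular_signed_measure (signed_by M h)"
    unfolding regular_signed_measure_def
  proof (intro ballI conjI)
    fix A :: "'k set" assume A: "A \<in> sets borel"
    have "(SUP C\<in>{C. C \<subseteq> A \<and> compact C}. total_variation (signed_by M h) C)
        = (SUP C\<in>{C. C \<subseteq> A \<and> compact C}. emeasure M C)"
      by (intro SUP_cong) (auto simp: tv borel_closed compact_imp_closed)
    then show "total_variation (signed_by M h) A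
        = (SUP C\<in>{C. C \<subseteq> A \<and> compact C}. total_variation (signed_by M h) C)"
      using MD(5)[OF A] by (simp add: tv A)
    have "(INF U\<in>{U. A \<subseteq> U \<and> open U}. total_variation (signed_by M h) U)
        = (INF U\<in>{U. A \<subseteq> U \<and> open U}. emeasure M U)"
      by (intro INF_cong) (auto simp: tv)
    then show "total_variation (signed_by M h) A
        = (INF U\<in>{U. A \<subseteq> U \<and> open U}. total_variation (signed_by M h) U)"
      using MD(6)[OF A] by (simp add: tv A)
  qed
  assume S: "closed S" "emeasure M (- S) = 0"
  define \<Z> where "\<Z> = {S. closed S \<and> total_variation (signed_by M h) (- S) = 0}"
  have Z: "\<Z> = {S. closed S \<and> emeasure M (- S) = 0}"
    unfolding \<Z>_def by (auto simp: tv)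
  have closed: "closed (\<Inter>\<Z>)"
    by (rule closed_Inter) (simp add: Z)
  have "emeasure M (- \<Inter>\<Z>) = 0"
  proof (rule regular_null_set_of_cover[OF M])
    show "- \<Inter>\<Z> \<in> sets borel"
      using closed by (simp add: borel_comp)
    fix y assume "y \<in> - \<Inter>\<Z>"
    then obtain S where "S \<in> \<Z>" "y \<notin> S" by blast
    then show "\<exists>V. open V \<and> y \<in> V \<and> emeasure M V = 0"
      by (intro exI[of _ "- S"]) (auto simp: Z)
  qed
  then have "\<Inter>\<Z> \<in> \<Z>"
    using closed by (simp add: Z)
  then have "supp (signed_by M h) = \<Inter>\<Z>"
    unfolding supp_def by (intro Least_equality) (auto simp: \<Z>_def)
  moreover have "S \<in> \<Z>"
    using S by (simp add: Z)
  ultimately show "supp (signed_by M h) \<subseteq> S" by blast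
qed

section \<open>Functionals that attain their norm\<close>

lemma apply_Bcontfun:
  assumes "compact (UNIV :: 'k::topological_space set)" "continuous_on UNIV (f :: 'k \<Rightarrow> real)"
  shows "apply_bcontfun (Bcontfun f) = f"
  using compact_imp_bounded[OF compact_continuous_image[OF assms(2,1)]] assms(2)
  by (intro Bcontfun_inverse) (simp add: bcontfun_def)

text \<open>
  A functional of norm 1 that attains its norm at \<open>h\<close> is represented by \<open>h\<close> times a probability
  measure. The functional \<open>\<Lambda> f = L (h f)\<close> satisfies \<open>\<Lambda> 1 = 1\<close> and has norm at most 1, which makes
  it positive: for \<open>0 \<le> f \<le> B\<close> the norm of \<open>B h - h f\<close> is at most \<open>B\<close>, so \<open>B - \<Lambda> f \<le> B\<close>.
  Moreover \<open>L\<close> vanishes on every \<open>k = (1 - h\<^sup>2) g\<close>: for small \<open>t\<close> both \<open>h + t k\<close> and \<open>h - t k\<close> stay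
  in the unit ball, so \<open>L\<close> cannot exceed its value 1 there. Hence \<open>L g = L (h\<^sup>2 g) = \<Lambda> (h g)\<close>, and
  the measure that represents \<open>\<Lambda>\<close> is concentrated where \<open>\<bar>h\<bar> = 1\<close>.
\<close>

theorem norm_attaining_functional_representation:
  fixes L :: "('k::t2_space \<Rightarrow>\<^sub>C real) \<Rightarrow> real" and h :: "'k \<Rightarrow>\<^sub>C real"
  assumes compact: "compact (UNIV :: 'k set)" and L: "linear L" and le: "\<And>g. \<bar>L g\<bar> \<le> norm g"
    and h: "norm h \<le> 1" "L h = 1"
  obtains M where "regular_borel_probability M" "AE y in M. \<bar>apply_bcontfun h y\<bar> = 1"
    "\<And>g :: 'k \<Rightarrow> real. continuous_on UNIV g \<Longrightarrow> integrable M g"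
    "\<And>g. L g = (LINT y|M. apply_bcontfun h y * apply_bcontfun g y)"
proof -
  interpret L: linear L by fact
  note app = apply_Bcontfun[OF compact]
  have h_le: "\<bar>apply_bcontfun h y\<bar> \<le> 1" for y
    using norm_bounded[of h y] h(1) by simp
  define m where "m f = Bcontfun (\<lambda>y. apply_bcontfun h y * f y)" for f
  have contm: "continuous_on UNIV (\<lambda>y. apply_bcontfun h y * f y)" if "continuous_on UNIV f" for f
    by (intro continuous_intros that) simp
  have m: "apply_bcontfun (m f) y = apply_bcontfun h y * f y" if "continuous_on UNIV f" for f y
    using contm[OF that] by (simp add: m_def app)
  define \<Lambda> where "\<Lambda> f = L (m f)" for f
  interpret \<Lambda>: positive_unital_functional \<Lambda>
  proof
    fix f g :: "'k \<Rightarrow> real" and c :: real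
    assume f: "continuous_on UNIV f"
    have "m (\<lambda>y. c * f y) = c *\<^sub>R m f"
      using f by (intro bcontfun_eqI) (simp add: m continuous_on_mult_left)
    then show "\<Lambda> (\<lambda>y. c * f y) = c * \<Lambda> f"
      by (simp add: \<Lambda>_def L.scale)
    show "\<Lambda> (\<lambda>y. f y + g y) = \<Lambda> f + \<Lambda> g" if g: "continuous_on UNIV g"
    proof -
      have "m (\<lambda>y. f y + g y) = m f + m g"
        using f g by (intro bcontfun_eqI) (simp add: m continuous_on_add distrib_left)
      then show ?thesis
        by (simp add: \<Lambda>_def L.add)
    qed
    assume pos: "\<And>y. 0 \<le> f y"
    have "bounded (range f)"
      using compact_continuous_image[OF f compact] by (rule compact_imp_bounded)
    then obtain B where B: "0 < B" "\<And>y. \<bar>f y\<bar> \<le> B"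
      by (auto simp: bounded_pos)
    have "\<bar>apply_bcontfun (B *\<^sub>R h - m f) y\<bar> \<le> B" for y
    proof -
      have "apply_bcontfun (B *\<^sub>R h - m f) y = apply_bcontfun h y * (B - f y)"
        using f by (simp add: m algebra_simps)
      moreover have "\<bar>apply_bcontfun h y\<bar> * \<bar>B - f y\<bar> \<le> 1 * B"
        using h_le[of y] pos[of y] B(2)[of y] by (intro mult_mono) auto
      ultimately show ?thesis by (simp add: abs_mult)
    qed
    then have "norm (B *\<^sub>R h - m f) \<le> B"
      by (intro norm_bound) simp
    with le[of "B *\<^sub>R h - m f"] have "L (B *\<^sub>R h - m f) \<le> B"
      by linarith
    then show "0 \<le> \<Lambda> f"
      using h(2) by (simp add: L.diff L.scale \<Lambda>_def)
  next
    show "\<Lambda> (\<lambda>_. 1) = 1"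
      using h(2) by (simp add: \<Lambda>_def m_def apply_bcontfun_inverse)
  qed (fact compact)
  let ?M = "\<Lambda>.representing_measure"
  have vanish: "L (Bcontfun (\<lambda>y. (1 - (apply_bcontfun h y)\<^sup>2) * apply_bcontfun g y)) = 0" for g
  proof -
    define k where "k = Bcontfun (\<lambda>y. (1 - (apply_bcontfun h y)\<^sup>2) * apply_bcontfun g y)"
    have k: "apply_bcontfun k y = (1 - (apply_bcontfun h y)\<^sup>2) * apply_bcontfun g y" for y
      unfolding k_def by (subst app) (auto intro!: continuous_intros)
    \<comment> \<open>With \<open>\<bar>t g\<bar> \<le> 1/2\<close> the bound below reads
      \<open>a + (1 - a\<^sup>2) / 2 = 1 - (1 - a)\<^sup>2 / 2 \<le> 1\<close> for \<open>a = \<bar>h y\<bar>\<close>.\<close>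
    define t where "t = 1 / (2 * (norm g + 1))"
    have t: "0 < t" "t * norm g \<le> 1 / 2"
      by (auto simp: t_def field_simps add_pos_nonneg)
    have small: "norm (h + c *\<^sub>R k) \<le> 1" if c: "\<bar>c\<bar> = t" for c
    proof (rule norm_bound)
      fix y
      let ?a = "\<bar>apply_bcontfun h y\<bar>" and ?g = "apply_bcontfun g y"
      have a: "0 \<le> ?a" "?a \<le> 1" using h_le by auto
      have "\<bar>c * ?g\<bar> \<le> t * norm g"
        using norm_bounded[of g y] c t(1) by (simp add: abs_mult mult_left_mono)
      then have "\<bar>c * ?g\<bar> \<le> 1 / 2"
        using t(2) by simp
      then have "(1 - ?a\<^sup>2) * \<bar>c * ?g\<bar> \<le> (1 - ?a\<^sup>2) * (1 / 2)"
        using a by (intro mult_left_mono) (auto simp: abs_square_le_1 power_le_one)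
      moreover have "(1 - ?a) * (1 - ?a) \<ge> 0" by simp
      ultimately have "?a + (1 - ?a\<^sup>2) * \<bar>c * ?g\<bar> \<le> 1"
        by (simp add: power2_eq_square algebra_simps)
      moreover have "\<bar>c * ((1 - ?a\<^sup>2) * ?g)\<bar> = (1 - ?a\<^sup>2) * \<bar>c * ?g\<bar>"
        using a by (simp add: abs_mult abs_square_le_1 power_le_one)
      ultimately show "norm (apply_bcontfun (h + c *\<^sub>R k) y) \<le> 1"
        using abs_triangle_ineq[of "apply_bcontfun h y" "c * ((1 - ?a\<^sup>2) * ?g)"] by (simp add: k)
    qed
    have "1 + c * L k \<le> 1" if "\<bar>c\<bar> = t" for c
      using le[of "h + c *\<^sub>R k"] small[OF that] h(2) by (simp add: L.add L.scale)
    from this[of t] this[of "- t"] have "t * L k = 0"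
      using t(1) by simp
    then show ?thesis
      using t(1) by (simp add: k_def)
  qed
  have L_eq: "L g = \<Lambda> (\<lambda>y. apply_bcontfun h y * apply_bcontfun g y)" for g
  proof -
    define k where "k = Bcontfun (\<lambda>y. (1 - (apply_bcontfun h y)\<^sup>2) * apply_bcontfun g y)"
    have "apply_bcontfun k y = (1 - (apply_bcontfun h y)\<^sup>2) * apply_bcontfun g y" for y
      unfolding k_def by (subst app) (auto intro!: continuous_intros)
    moreover have "apply_bcontfun (m (\<lambda>y. apply_bcontfun h y * apply_bcontfun g y)) y
        = (apply_bcontfun h y)\<^sup>2 * apply_bcontfun g y" for y
      by (subst m) (auto intro!: contm simp: power2_eq_square)
    ultimately have "g = m (\<lambda>y. apply_bcontfun h y * apply_bcontfun g y) + k"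
      by (intro bcontfun_eqI) (simp add: algebra_simps)
    then have "L g = L (m (\<lambda>y. apply_bcontfun h y * apply_bcontfun g y)) + L k"
      by (metis L.add)
    then show ?thesis
      by (simp add: vanish k_def \<Lambda>_def)
  qed
  show thesis
  proof (rule that[of ?M])
    show "regular_borel_probability ?M"
      unfolding regular_borel_probability_def
      by (intro conjI ballI \<Lambda>.sets_representing_measure \<Lambda>.emeasure_representing_measure_UNIV
        \<Lambda>.inner_regular_representing_measure \<Lambda>.outer_regular_representing_measure)
    show "integrable ?M g" if "continuous_on UNIV g" for g :: "'k \<Rightarrow> real"
      using that by (rule \<Lambda>.integrable_representing_measure)
    show "L g = (LINT y|?M. apply_bcontfun h y * apply_bcontfun g y)" for g
      unfolding L_eq by (rule \<Lambda>.integral_representing_measure[symmetric]) (intro contm, simp)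
    have int: "integrable ?M (\<lambda>y. 1 - (apply_bcontfun h y)\<^sup>2)"
      by (intro \<Lambda>.integrable_representing_measure continuous_intros) simp
    have "(LINT y|?M. 1 - (apply_bcontfun h y)\<^sup>2) = \<Lambda> (\<lambda>y. 1 - (apply_bcontfun h y)\<^sup>2)"
      by (intro \<Lambda>.integral_representing_measure continuous_intros) simp
    also have "\<dots> = 0"
      using vanish[of h] by (simp add: \<Lambda>_def m_def mult.commute)
    finally have "AE y in ?M. 1 - (apply_bcontfun h y)\<^sup>2 = 0"
      using h_le by (subst (asm) integral_nonneg_eq_0_iff_AE[OF int]) (auto simp: abs_square_le_1)
    then show "AE y in ?M. \<bar>apply_bcontfun h y\<bar> = 1"
      by eventually_elim (simp add: abs_square_eq_1)
  qed
qed

section \<open>Isometric embeddings and evaluation functionals\<close>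

text \<open>
  If \<open>f x = 0\<close> and \<open>norm f \<le> 1\<close>, then the three functions \<open>1 - \<bar>f\<bar> + c f\<close> with \<open>c = 0, 1, -1\<close> all
  peak at \<open>x\<close>, so \<open>\<theta>\<close> takes values in \<open>{1, -1}\<close> on each of them. Three equally spaced numbers in
  \<open>{1, -1}\<close> coincide, whence \<open>\<theta> f = 0\<close>. So \<open>\<theta>\<close> is the evaluation at \<open>x\<close> times the constant \<open>\<theta> 1\<close>,
  which has absolute value 1.
\<close>

lemma abs_functional_eq_abs_eval:
  fixes \<theta> :: "('l::topological_space \<Rightarrow>\<^sub>C real) \<Rightarrow> real"
  assumes compact: "compact (UNIV :: 'l set)" and lin: "linear \<theta>"
    and le: "\<And>f. \<bar>\<theta> f\<bar> \<le> norm f"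
    and peak: "\<And>k. norm k \<le> 1 \<Longrightarrow> apply_bcontfun k x = 1 \<Longrightarrow> 1 \<le> \<bar>\<theta> k\<bar>"
  shows "\<bar>\<theta> f\<bar> = \<bar>apply_bcontfun f x\<bar>"
proof -
  interpret linear \<theta> by fact
  have unimodular: "\<theta> k = 1 \<or> \<theta> k = - 1" if "norm k \<le> 1" "apply_bcontfun k x = 1" for k
    using peak[OF that] le[of k] that(1) by linarith
  have small: "\<theta> f = 0" if f: "apply_bcontfun f x = 0" "norm f \<le> 1" for f
  proof -
    define a where "a = Bcontfun (\<lambda>z. 1 - \<bar>apply_bcontfun f z\<bar>)"
    have a: "apply_bcontfun a z = 1 - \<bar>apply_bcontfun f z\<bar>" for z
      unfolding a_def by (subst apply_Bcontfun[OF compact]) (auto intro!: continuous_intros)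
    have "norm (a + c *\<^sub>R f) \<le> 1 \<and> apply_bcontfun (a + c *\<^sub>R f) x = 1" if c: "\<bar>c\<bar> \<le> 1" for c
    proof (intro conjI norm_bound)
      fix z
      have "\<bar>apply_bcontfun f z\<bar> \<le> 1"
        using norm_bounded[of f z] f(2) by simp
      moreover have "\<bar>c * apply_bcontfun f z\<bar> \<le> 1 * \<bar>apply_bcontfun f z\<bar>"
        unfolding abs_mult using c by (intro mult_right_mono) auto
      ultimately show "norm (apply_bcontfun (a + c *\<^sub>R f) z) \<le> 1"
        by (simp add: a)
    qed (simp add: a f(1))
    then have "\<theta> a + c * \<theta> f = 1 \<or> \<theta> a + c * \<theta> f = - 1" if "\<bar>c\<bar> \<le> 1" for c
      using unimodular[of "a + c *\<^sub>R f"] that by (simp add: add scale)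
    from this[of 0] this[of 1] this[of "- 1"] show ?thesis
      by auto
  qed
  have vanish: "\<theta> f = 0" if "apply_bcontfun f x = 0" for f
  proof (cases "f = 0")
    case False
    have "\<theta> ((1 / norm f) *\<^sub>R f) = 0"
      using that False by (intro small) auto
    then show ?thesis
      using False by (simp add: scale)
  qed (simp add: zero)
  define u where "u = (const_bcontfun 1 :: 'l \<Rightarrow>\<^sub>C real)"
  have "\<theta> (f - apply_bcontfun f x *\<^sub>R u) = 0"
    by (rule vanish) (simp add: u_def)
  then have "\<theta> f = apply_bcontfun f x * \<theta> u"
    by (simp add: diff scale)
  moreover have "\<theta> u = 1 \<or> \<theta> u = - 1"
    by (rule unimodular) (auto intro: norm_bound simp: u_def)
  ultimately show ?thesis
    by (auto simp: abs_mult)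
qed

lemma exists_bcontfun_supported_in:
  fixes x :: "'l::t2_space"
  assumes compact: "compact (UNIV :: 'l set)" and "open U" "x \<in> U"
  obtains f :: "'l \<Rightarrow>\<^sub>C real"
  where "apply_bcontfun f x = 1" "\<And>z. z \<notin> U \<Longrightarrow> apply_bcontfun f z = 0"
proof -
  have "closed (- U)" "closed {x}" "- U \<inter> {x} = {}"
    using assms by auto
  from Urysohn_compact_t2[OF compact this]
  obtain f where "continuous_on UNIV f" "\<And>z. z \<in> - U \<Longrightarrow> f z = (0::real)"
      "\<And>z. z \<in> {x} \<Longrightarrow> f z = 1"
    by metis
  then show thesis
    using apply_Bcontfun[OF compact, of f] by (intro that[of "Bcontfun f"]) auto
qed

text \<open>
  For a function \<open>k\<close> in the unit ball with \<open>k x = 1\<close>, the integral of \<open>h T k \<le> 1\<close> against the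
  probability measure \<open>M\<close> equals 1, so the open set \<open>{z. \<bar>T k z\<bar> < 1}\<close> is null. By the
  characterisation of evaluation functionals up to sign, these sets cover the complement of the set
  where \<open>\<bar>T f y\<bar> = \<bar>f x\<bar>\<close> for all \<open>f\<close>.
\<close>

lemma representing_measure_concentrated:
  fixes T :: "('l::t2_space \<Rightarrow>\<^sub>C real) \<Rightarrow> ('k::t2_space \<Rightarrow>\<^sub>C real)" and h :: "'k \<Rightarrow>\<^sub>C real"
  assumes compact: "compact (UNIV :: 'l set)"
    and T: "linear T" "\<And>f. norm (T f) \<le> norm f" and h: "norm h \<le> 1"
    and M: "regular_borel_probability M"
    and int: "\<And>g :: 'k \<Rightarrow> real. continuous_on UNIV g \<Longrightarrow> integrable M g"
    and eval: "\<And>k. (LINT y|M. apply_bcontfun h y * apply_bcontfun (T k) y) = apply_bcontfun k x"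
  defines "G \<equiv> {y. \<forall>f. \<bar>apply_bcontfun (T f) y\<bar> = \<bar>apply_bcontfun f x\<bar>}"
  shows "closed G" "emeasure M (- G) = 0"
proof -
  note MD = regular_borel_probabilityD[OF M]
  interpret T: linear T by fact
  have T_le: "\<bar>apply_bcontfun (T f) y\<bar> \<le> norm f" for f y
    using norm_bounded[of "T f" y] T(2)[of f] by simp
  have linT: "linear (\<lambda>f. apply_bcontfun (T f) y)" for y
    by standard (simp_all add: T.add T.scale)
  show closedG: "closed G"
    unfolding G_def by (intro closed_Collect_all closed_Collect_eq continuous_intros) simp_all
  show "emeasure M (- G) = 0"
  proof (rule regular_null_set_of_cover[OF M])
    show "- G \<in> sets borel"
      using closedG by (simp add: borel_comp)
    fix y assume "y \<in> - G"
    then have "\<not> (\<forall>f. \<bar>apply_bcontfun (T f) y\<bar> = \<bar>apply_bcontfun f x\<bar>)"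
      by (simp add: G_def)
    then obtain k where k: "norm k \<le> 1" "apply_bcontfun k x = 1" "\<bar>apply_bcontfun (T k) y\<bar> < 1"
      using abs_functional_eq_abs_eval[OF compact linT T_le, of x y] by (meson not_le)
    let ?V = "{z. \<bar>apply_bcontfun (T k) z\<bar> < 1}"
    let ?p = "\<lambda>z. 1 - apply_bcontfun h z * apply_bcontfun (T k) z"
    have le: "apply_bcontfun h z * apply_bcontfun (T k) z \<le> \<bar>apply_bcontfun (T k) z\<bar>"
      "\<bar>apply_bcontfun (T k) z\<bar> \<le> 1" for z
    proof -
      show "\<bar>apply_bcontfun (T k) z\<bar> \<le> 1"
        using T_le[of k z] k(1) by simp
      have "\<bar>apply_bcontfun h z\<bar> \<le> 1"
        using norm_bounded[of h z] h by simp
      then have "\<bar>apply_bcontfun h z * apply_bcontfun (T k) z\<bar> \<le> 1 * \<bar>apply_bcontfun (T k) z\<bar>"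
        unfolding abs_mult by (intro mult_right_mono) auto
      then show "apply_bcontfun h z * apply_bcontfun (T k) z \<le> \<bar>apply_bcontfun (T k) z\<bar>"
        by simp
    qed
    have intp: "integrable M ?p"
      by (intro int continuous_intros) simp_all
    have "(LINT z|M. ?p z) = 1 - (LINT z|M. apply_bcontfun h z * apply_bcontfun (T k) z)"
      using MD(2,3) finite_measure.integrable_const[OF MD(4)]
      by (subst Bochner_Integration.integral_diff)
        (auto intro!: int continuous_intros simp: measure_def)
    also have "\<dots> = 0"
      using eval[of k] k(2) by simp
    finally have "AE z in M. ?p z = 0"
      using le by (subst (asm) integral_nonneg_eq_0_iff_AE[OF intp]) (auto intro: order_trans)
    then have "AE z in M. z \<notin> ?V"
    proof eventually_elim
      case (elim z)
      then show ?case using le[of z] by simp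
    qed
    moreover have openV: "open ?V"
      by (intro open_Collect_less continuous_intros) simp_all
    ultimately have "emeasure M ?V = 0"
      by (subst (asm) AE_iff_null_sets[symmetric]) (auto simp: MD(1))
    then show "\<exists>V. open V \<and> y \<in> V \<and> emeasure M V = 0"
      using k(3) openV by blast
  qed
qed

text \<open>
  The topology of \<open>measure_sphere F\<close> is tested by continuous functions on \<open>F\<close>. By Tietze's theorem
  they are the restrictions of the continuous functions on the whole space, so it suffices to test
  with the latter, cut off outside \<open>F\<close>.
\<close>

lemma continuous_map_weak_star_sphere:
  fixes F :: "'k::t2_space set" and \<phi> :: "'l::topological_space \<Rightarrow> 'k set \<Rightarrow> real"
  assumes compact: "compact (UNIV :: 'k set)" and F: "closed F"
    and \<phi>: "\<And>x. \<phi> x \<in> measure_sphere F"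
    and cont: "\<And>k :: 'k \<Rightarrow>\<^sub>C real.
      continuous_on UNIV (\<lambda>x. signed_integral (\<phi> x) (\<lambda>y. indicator F y * apply_bcontfun k y))"
  shows "continuous_map euclidean (weak_star_sphere F) \<phi>"
proof -
  have \<phi>_on: "\<phi> x \<in> measures_on F" for x
    using \<phi>[of x] by (simp add: measure_sphere_def)
  show ?thesis
    unfolding weak_star_sphere_def continuous_map_in_subtopology
  proof
    show "continuous_map euclidean (weak_star F) \<phi>"
      unfolding weak_star_def
    proof (rule continuous_on_generated_topo)
      fix W assume "W \<in> {{\<mu> \<in> measures_on F. signed_integral \<mu> (\<lambda>y. if y \<in> F then g y else 0) \<in> U} | g U.
        continuous_on F g \<and> open U}"
      then obtain g U where W: "W = {\<mu> \<in> measures_on F. signed_integral \<mu> (\<lambda>y. if y \<in> F then g y else 0) \<in> U}"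
        and g: "continuous_on F g" and U: "open U" by blast
      obtain g' where g': "continuous_map euclidean euclideanreal g'" "\<And>y. y \<in> F \<Longrightarrow> g' y = g y"
        using Tietze_extension_realinterval[OF normal_space_compact_t2[OF compact], of F UNIV g] F g
        by auto
      define k where "k = Bcontfun g'"
      have k: "apply_bcontfun k = g'"
        using g'(1) by (simp add: k_def apply_Bcontfun[OF compact])
      have eq: "(\<lambda>y. if y \<in> F then g y else 0) = (\<lambda>y. indicator F y * apply_bcontfun k y)"
        by (auto simp: k g'(2) fun_eq_iff)
      have "\<phi> -` W \<inter> topspace euclidean
          = (\<lambda>x. signed_integral (\<phi> x) (\<lambda>y. indicator F y * apply_bcontfun k y)) -` U"
        by (auto simp: W \<phi>_on eq)
      then show "openin euclidean (\<phi> -` W \<inter> topspace euclidean)"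
        using open_vimage[OF U cont[of k]] by simp
    next
      have "measures_on F = {\<mu> \<in> measures_on F. signed_integral \<mu> (\<lambda>y. if y \<in> F then 0 else 0) \<in> UNIV}"
        by simp
      then have "measures_on F \<in> {{\<mu> \<in> measures_on F. signed_integral \<mu> (\<lambda>y. if y \<in> F then g y else 0) \<in> U} | g U.
          continuous_on F g \<and> open U}"
        by (intro CollectI exI[of _ "\<lambda>_. 0"] exI[of _ UNIV]) auto
      then show "\<phi> ` topspace euclidean \<subseteq> \<Union> {{\<mu> \<in> measures_on F. signed_integral \<mu> (\<lambda>y. if y \<in> F then g y else 0) \<in> U} | g U.
          continuous_on F g \<and> open U}"
        using \<phi>_on by blast
    qed
    show "\<phi> \<in> topspace euclidean \<rightarrow> measure_sphere F"
      using \<phi> by auto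
  qed
qed

section \<open>Isometries onto the range of a norm-one projection\<close>

theorem theorem1p4:
  fixes T :: "('l::t2_space \<Rightarrow>\<^sub>C real) \<Rightarrow> ('k::t2_space \<Rightarrow>\<^sub>C real)"
    and P :: "('k \<Rightarrow>\<^sub>C real) \<Rightarrow> ('k \<Rightarrow>\<^sub>C real)"
    and E :: "('k \<Rightarrow>\<^sub>C real) set"
  assumes "compact (UNIV :: 'k set)"
    and "compact (UNIV :: 'l set)"
    and "complemented_subspace E"
    and "linear_isometry_onto T E"
    and "projection_onto E P"
    and "onorm P = 1"
  shows "\<exists>(F :: 'k set) (\<rho> :: 'k \<Rightarrow> 'l) (\<sigma> :: 'k \<Rightarrow> real) (\<phi> :: 'l \<Rightarrow> 'k set \<Rightarrow> real).
    closed F \<and>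
    continuous_on F \<rho> \<and> \<rho> ` F = UNIV \<and>
    continuous_on F \<sigma> \<and> \<sigma> ` F \<subseteq> {-1, 1} \<and>
    continuous_map euclidean (weak_star_sphere F) \<phi> \<and>
    (\<forall>x. supp (\<phi> x) \<subseteq> {y \<in> F. \<rho> y = x}) \<and>
    (\<forall>f. \<forall>y\<in>F. apply_bcontfun (T f) y = \<sigma> y * apply_bcontfun f (\<rho> y)) \<and>
    (\<forall>g. \<forall>y\<in>F. apply_bcontfun (P g) y =
        \<sigma> y * signed_integral (\<phi> (\<rho> y)) (apply_bcontfun g))"
proof -
  note compactK = assms(1) and compactL = assms(2)
  interpret T: linear T
    using assms(4) by (simp add: linear_isometry_onto_def)
  have norm_T: "norm (T f) = norm f" for f
    using assms(4) by (simp add: linear_isometry_onto_def)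
  have T_inj: "f = g" if "T f = T g" for f g
    using norm_T[of "f - g"] that by (simp add: T.diff)
  have blP: "bounded_linear P" and PE: "P g \<in> range T" and PT: "P (T f) = T f" for g f
    using assms(4,5) by (auto simp: projection_onto_def linear_isometry_onto_def)
  interpret P: bounded_linear P by fact
  have norm_P: "norm (P g) \<le> norm g" for g
    using onorm[OF blP, of g] assms(6) by simp
  define Q where "Q g = inv T (P g)" for g
  have TQ: "T (Q g) = P g" for g
    unfolding Q_def using PE by (rule f_inv_into_f)
  have QT: "Q (T f) = f" for f
    by (rule T_inj) (simp add: TQ PT)
  have norm_Q: "norm (Q g) \<le> norm g" for g
    using norm_P[of g] norm_T[of "Q g"] by (simp add: TQ)
  have linQ: "linear (\<lambda>g. apply_bcontfun (Q g) x)" for x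
  proof
    fix a b and r :: real
    have "Q (a + b) = Q a + Q b"
      by (rule T_inj) (simp add: TQ T.add P.add)
    then show "apply_bcontfun (Q (a + b)) x = apply_bcontfun (Q a) x + apply_bcontfun (Q b) x"
      by simp
    have "Q (r *\<^sub>R a) = r *\<^sub>R Q a"
      by (rule T_inj) (simp add: TQ T.scale P.scale)
    then show "apply_bcontfun (Q (r *\<^sub>R a)) x = r *\<^sub>R apply_bcontfun (Q a) x"
      by simp
  qed
  have Q_le: "\<bar>apply_bcontfun (Q g) x\<bar> \<le> norm g" for g x
    using norm_bounded[of "Q g" x] norm_Q[of g] by simp
  \<comment> \<open>The sign function \<open>\<sigma>\<close> is the image \<open>h\<close> of the constant 1; the functionals \<open>g \<mapsto> Q g x\<close>
    all attain their norm at \<open>h\<close>.\<close>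
  define u where "u = (const_bcontfun 1 :: 'l \<Rightarrow>\<^sub>C real)"
  have u: "norm u \<le> 1" "apply_bcontfun u x = 1" for x
    by (auto intro: norm_bound simp: u_def)
  define h where "h = T u"
  have h_borel: "apply_bcontfun h \<in> borel_measurable borel"
    by (intro borel_measurable_continuous_onI) simp
  have "\<exists>M. regular_borel_probability M \<and> (AE y in M. \<bar>apply_bcontfun h y\<bar> = 1) \<and>
      (\<forall>g :: 'k \<Rightarrow> real. continuous_on UNIV g \<longrightarrow> integrable M g) \<and>
      (\<forall>g. apply_bcontfun (Q g) x = (LINT y|M. apply_bcontfun h y * apply_bcontfun g y))" for x
  proof -
    have "norm h \<le> 1" "apply_bcontfun (Q h) x = 1"
      using u by (simp_all add: h_def norm_T QT)
    from norm_attaining_functional_representation[OF compactK linQ Q_le this]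
    show ?thesis by metis
  qed
  then obtain M where M: "\<And>x. regular_borel_probability (M x)"
    and h1: "\<And>x. AE y in M x. \<bar>apply_bcontfun h y\<bar> = 1"
    and int: "\<And>x (g :: 'k \<Rightarrow> real). continuous_on UNIV g \<Longrightarrow> integrable (M x) g"
    and Q_eq: "\<And>x g. apply_bcontfun (Q g) x = (LINT y|M x. apply_bcontfun h y * apply_bcontfun g y)"
    by metis
  note MD = regular_borel_probabilityD[OF M]
  define \<phi> where "\<phi> x = signed_by (M x) (apply_bcontfun h)" for x
  note tv = total_variation_signed_by[OF MD(1,4) h_borel h1, folded \<phi>_def]
  note sint = signed_integral_signed_by[OF MD(1,4) h_borel h1, folded \<phi>_def]

  \<comment> \<open>The condition says that \<open>f \<mapsto> T f y\<close> is plus or minus the evaluation at \<open>x\<close>; in terms of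
    absolute values this is a closed condition on the pair \<open>(y, x)\<close>.\<close>
  define G where "G x = {y. \<forall>f. \<bar>apply_bcontfun (T f) y\<bar> = \<bar>apply_bcontfun f x\<bar>}" for x
  define F where "F = (\<Union>x. G x)"
  have T_le: "norm (T f) \<le> norm f" and h_le: "norm h \<le> 1" for f
    using u(1) by (simp_all add: h_def norm_T)
  have T_eval: "(LINT y|M x. apply_bcontfun h y * apply_bcontfun (T k) y) = apply_bcontfun k x" for k x
    using Q_eq[of "T k" x] by (simp add: QT)
  note concentrated =
    representing_measure_concentrated[OF compactL T.linear_axioms T_le h_le M int T_eval, folded G_def]
  have closedG: "closed (G x)" and null: "emeasure (M x) (- G x) = 0" for x
    using concentrated by simp_all
  have nonempty: "G x \<noteq> {}" for x
    using null[of x] MD(2)[of x] by auto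
  have T_eq: "apply_bcontfun (T f) y = apply_bcontfun h y * apply_bcontfun f x" if "y \<in> G x" for f x y
  proof -
    have "\<bar>apply_bcontfun (T (f - apply_bcontfun f x *\<^sub>R u)) y\<bar> = 0"
      using that u(2) unfolding G_def by simp
    then show ?thesis
      by (simp add: T.diff T.scale h_def)
  qed
  have h_abs: "\<bar>apply_bcontfun h y\<bar> = 1" if "y \<in> F" for y
    using that u(2) by (auto simp: F_def G_def h_def)
  have unique: "x = x'" if "y \<in> G x" "y \<in> G x'" for x x' y
  proof (rule ccontr)
    assume "x \<noteq> x'"
    then have "open (- {x'})" "x \<in> - {x'}"
      by auto
    then obtain f :: "'l \<Rightarrow>\<^sub>C real" where f: "apply_bcontfun f x = 1" "apply_bcontfun f x' = 0"
      using exists_bcontfun_supported_in[OF compactL] by (metis ComplD singletonI)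
    have "\<bar>apply_bcontfun f x\<bar> = \<bar>apply_bcontfun f x'\<bar>"
      using that by (simp add: G_def)
    then show False
      using f by simp
  qed
  define \<rho> where "\<rho> y = (SOME x. y \<in> G x)" for y
  have \<rho>: "y \<in> G (\<rho> y)" if "y \<in> F" for y
    using that someI_ex[of "\<lambda>x. y \<in> G x"] by (auto simp: F_def \<rho>_def)
  have \<rho>_eq: "\<rho> y = x \<and> y \<in> F" if "y \<in> G x" for x y
  proof -
    have "y \<in> F"
      using that by (auto simp: F_def)
    then show ?thesis
      using unique[OF \<rho> that] by blast
  qed

  have closedF: "closed F"
  proof -
    \<comment> \<open>\<open>F\<close> is the projection to the first factor of a closed subset of the compact product.\<close>
    define R where "R = {p :: 'k \<times> 'l. \<forall>f. \<bar>apply_bcontfun (T f) (fst p)\<bar> = \<bar>apply_bcontfun f (snd p)\<bar>}"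
    have "closed R"
      unfolding R_def
      by (intro closed_Collect_all closed_Collect_eq continuous_intros
          continuous_on_compose2[OF continuous_on_apply_bcontfun]) auto
    moreover have "compact (UNIV :: ('k \<times> 'l) set)"
      using compact_Times[OF compactK compactL] by simp
    ultimately have "compact R"
      using compact_Int_closed[of UNIV R] by simp
    then have "compact (fst ` R)"
      by (intro compact_continuous_image continuous_intros)
    moreover have "F = fst ` R"
      unfolding Domain_fst[symmetric] by (simp add: F_def G_def R_def set_eq_iff Domain_iff)
    ultimately show ?thesis
      by (simp add: compact_imp_closed)
  qed
  have cont\<rho>: "continuous_on F \<rho>"
    unfolding continuous_on_topological
  proof (intro ballI allI impI)
    fix y U assume y: "y \<in> F" and U: "open U" "\<rho> y \<in> U"
    obtain f :: "'l \<Rightarrow>\<^sub>C real"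
      where f: "apply_bcontfun f (\<rho> y) = 1" "\<And>z. z \<notin> U \<Longrightarrow> apply_bcontfun f z = 0"
      using exists_bcontfun_supported_in[OF compactL U] by blast
    \<comment> \<open>As \<open>T f = h (f \<circ> \<rho>)\<close> on \<open>F\<close> and \<open>h\<close> has no zeros there, \<open>f \<circ> \<rho>\<close> and \<open>T f\<close> have the same zeros.\<close>
    let ?A = "{z. apply_bcontfun (T f) z \<noteq> 0}"
    have "open ?A"
      by (intro open_Collect_neq continuous_intros) simp_all
    moreover have "y \<in> ?A"
      using T_eq[OF \<rho>[OF y], of f] f(1) h_abs[OF y] by auto
    moreover have "\<forall>z\<in>F. z \<in> ?A \<longrightarrow> \<rho> z \<in> U"
      using T_eq[OF \<rho>, of _ f] f(2) by fastforce
    ultimately show "\<exists>A. open A \<and> y \<in> A \<and> (\<forall>z\<in>F. z \<in> A \<longrightarrow> \<rho> z \<in> U)"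
      by blast
  qed
  have supp\<phi>: "supp (\<phi> x) \<subseteq> G x" for x
    unfolding \<phi>_def by (rule supp_signed_by[OF M h_borel h1 closedG null])
  have G_F: "G x \<subseteq> F" for x
    by (auto simp: F_def)
  have \<phi>_on: "\<phi> x \<in> measures_on F" for x
    using supp\<phi>[of x] G_F[of x] signed_borel_measure_signed_by[OF MD(1,4) h_borel, of x]
      signed_by_regular[OF M h_borel h1, of x]
    by (auto simp: measures_on_def \<phi>_def)
  have \<phi>_sphere: "\<phi> x \<in> measure_sphere F" for x
    using \<phi>_on tv[of UNIV x] MD(2)[of x] by (simp add: measure_sphere_def)
  have \<phi>_int: "signed_integral (\<phi> x) (apply_bcontfun g) = apply_bcontfun (Q g) x" for x g
    using sint[of x "apply_bcontfun g"] int[of "apply_bcontfun g" x] by (simp add: Q_eq)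
  have AE_F: "AE y in M x. y \<in> F" for x
  proof -
    have "- F \<in> null_sets (M x)"
    proof (rule null_sets_subset)
      show "- G x \<in> null_sets (M x)"
        using null[of x] closedG[of x] by (simp add: null_sets_def MD(1) borel_comp)
      show "- F \<in> sets (M x)"
        using closedF by (simp add: MD(1) borel_comp)
    qed (use G_F in blast)
    then show ?thesis
      using AE_not_in[of "- F" "M x"] by simp
  qed
  have \<phi>_int_F: "signed_integral (\<phi> x) (\<lambda>y. indicator F y * apply_bcontfun k y)
      = apply_bcontfun (Q k) x" for x k
  proof -
    have F_sets: "F \<in> sets (M x)"
      using closedF by (simp add: MD(1) borel_closed)
    have "integrable (M x) (\<lambda>y. indicator F y * apply_bcontfun k y)"
      using integrable_mult_indicator[OF F_sets int, of "apply_bcontfun k"] by simp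
    then have "signed_integral (\<phi> x) (\<lambda>y. indicator F y * apply_bcontfun k y)
        = (LINT y|M x. apply_bcontfun h y * (indicator F y * apply_bcontfun k y))"
      by (rule sint)
    also have "\<dots> = (LINT y|M x. apply_bcontfun h y * apply_bcontfun k y)"
      using AE_F[of x] F_sets int[of "apply_bcontfun k" x] int[of "apply_bcontfun h" x]
      by (intro integral_cong_AE) (auto elim!: eventually_mono)
    finally show ?thesis
      by (simp add: Q_eq)
  qed
  have cont\<phi>: "continuous_map euclidean (weak_star_sphere F) \<phi>"
    by (rule continuous_map_weak_star_sphere[OF compactK closedF \<phi>_sphere]) (simp add: \<phi>_int_F)
  show ?thesis
  proof (rule exI[of _ F], rule exI[of _ \<rho>], rule exI[of _ "apply_bcontfun h"], rule exI[of _ \<phi>],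
      intro conjI allI ballI)
    show "\<rho> ` F = UNIV"
      using nonempty \<rho>_eq by (metis all_not_in_conv image_eqI surjI UNIV_eq_I)
    show "continuous_on F (apply_bcontfun h)" by simp
    show "apply_bcontfun h ` F \<subseteq> {- 1, 1}"
    proof (rule image_subsetI)
      fix y assume "y \<in> F"
      from h_abs[OF this] have "apply_bcontfun h y = - 1 \<or> apply_bcontfun h y = 1"
        by linarith
      then show "apply_bcontfun h y \<in> {- 1, 1}"
        by simp
    qed
    show "supp (\<phi> x) \<subseteq> {y \<in> F. \<rho> y = x}" for x
      using supp\<phi>[of x] \<rho>_eq by blast
    show "apply_bcontfun (T f) y = apply_bcontfun h y * apply_bcontfun f (\<rho> y)" if "y \<in> F" for f y
      using T_eq[OF \<rho>[OF that]] .
    show "apply_bcontfun (P g) y = apply_bcontfun h y * signed_integral (\<phi> (\<rho> y)) (apply_bcontfun g)"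
      if "y \<in> F" for g y
      using T_eq[OF \<rho>[OF that], of "Q g"] by (simp add: TQ \<phi>_int)
  qed (fact closedF cont\<rho> cont\<phi>)+
qed

end
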